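(* For every integer $k\geq 3$ there are positive constants $d_{\text{ind.}}$, $\varepsilon_{\text{ind.}}$ and $\alpha_{\text{ind.}}$ such that, in the bounded degree model with degree bound $d_{\text{ind.}}$ and proximity parameter $\varepsilon_{\text{ind.}}$, the query complexity of testing whether the independence number of a $k$-uniform $n$-vertex hypergraph is at least $n/\alpha_{\text{ind.}}$ is $\Omega(n)$.
   Context: A hypergraph is $k$-uniform if every hyperedge has exactly $k$ vertices. A set of vertices is independent if no hyperedge is fully contained in it; the independence number is the maximum size of an independent set. Bounded degree model: a hypergraph of maximum degree at most $\Delta$ is accessed via queries to lists $A_1,\dots,A_n$ of length $\Delta$, $A_i$ listing the hyperedges incident to vertex $i$ padded with $\bot$. Distance between $H_1=([n],E_1)$, $H_2=([n],E_2)$ is $(|E_1\setminus E_2|+|E_2\setminus E_1|)/(\Delta n)$; $H$ is $\varepsilon$-far from a property if its distance to every $k$-uniform $n$-vertex hypergraph with the property exceeds $\varepsilon$. An $\varepsilon$-tester accepts with probability $\ge 2/3$ inputs having the property and with probability $\le 1/3$ inputs $\varepsilon$-far from it; "query complexity $\Omega(n)$" means every such tester makes $\Omega(n)$ queries in the worst case. *)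

theory Defs
  imports "HOL-Probability.Probability"
begin

definition uniform_hypergraph :: "nat \<Rightarrow> nat \<Rightarrow> nat set set \<Rightarrow> bool" where
  "uniform_hypergraph k n E \<longleftrightarrow> (\<forall>e\<in>E. e \<subseteq> {1..n} \<and> card e = k)"

definition vertex_degree :: "nat set set \<Rightarrow> nat \<Rightarrow> nat" where
  "vertex_degree E i = card {e \<in> E. i \<in> e}"

definition max_degree_le :: "nat \<Rightarrow> nat \<Rightarrow> nat set set \<Rightarrow> bool" where
  "max_degree_le n d E \<longleftrightarrow> (\<forall>i\<in>{1..n}. vertex_degree E i \<le> d)"

definition independent_set :: "nat \<Rightarrow> nat set set \<Rightarrow> nat set \<Rightarrow> bool" where
  "independent_set n E S \<longleftrightarrow> S \<subseteq> {1..n} \<and> \<not> (\<exists>e\<in>E. e \<subseteq> S)"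

definition independence_number :: "nat \<Rightarrow> nat set set \<Rightarrow> nat" where
  "independence_number n E = Max {card S | S. independent_set n E S}"

text \<open>
  A property of hypergraphs is a predicate on the number of vertices and the hyperedge set.
\<close>

type_synonym hypergraph_property = "nat \<Rightarrow> nat set set \<Rightarrow> bool"

definition independence_number_ge :: "real \<Rightarrow> hypergraph_property" where
  "independence_number_ge \<alpha> n E \<longleftrightarrow> real (independence_number n E) \<ge> real n / \<alpha>"

definition hypergraph_dist :: "nat \<Rightarrow> nat \<Rightarrow> nat set set \<Rightarrow> nat set set \<Rightarrow> real" where
  "hypergraph_dist d n E1 E2 =
     (real (card (E1 - E2)) + real (card (E2 - E1))) / (real d * real n)"

definition far_from ::
  "nat \<Rightarrow> nat \<Rightarrow> real \<Rightarrow> hypergraph_property \<Rightarrow> nat \<Rightarrow> nat set set \<Rightarrow> bool" where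
  "far_from k d \<epsilon> P n E \<longleftrightarrow>
     (\<forall>E'. uniform_hypergraph k n E' \<and> P n E' \<longrightarrow> hypergraph_dist d n E E' > \<epsilon>)"

text \<open>
  The same hypergraph is presented by many families of lists, as the order of the hyperedges
  within each list is arbitrary; \<^term>\<open>None\<close> is the padding symbol.
\<close>

type_synonym incidence_lists = "nat \<Rightarrow> nat set option list"

definition represents :: "nat \<Rightarrow> nat \<Rightarrow> incidence_lists \<Rightarrow> nat set set \<Rightarrow> bool" where
  "represents n d A E \<longleftrightarrow>
     (\<forall>i\<in>{1..n}. \<exists>es. distinct es \<and> set es = {e \<in> E. i \<in> e} \<and> length es \<le> d \<and>
        A i = map Some es @ replicate (d - length es) None)"

definition bounded_degree_input ::
  "nat \<Rightarrow> nat \<Rightarrow> nat \<Rightarrow> nat set set \<Rightarrow> incidence_lists \<Rightarrow> bool" where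
  "bounded_degree_input k d n E A \<longleftrightarrow>
     uniform_hypergraph k n E \<and> max_degree_le n d E \<and> represents n d A E"

text \<open>
  List positions are counted from 0.  Queries outside the lists carry no information.
\<close>

definition answer :: "nat \<Rightarrow> nat \<Rightarrow> incidence_lists \<Rightarrow> nat \<Rightarrow> nat \<Rightarrow> nat set option" where
  "answer n d A i j = (if i \<in> {1..n} \<and> j < d then A i ! j else None)"

text \<open>
  A deterministic adaptive query algorithm is a decision tree: \<open>Query i j f\<close> asks for
  position \<open>j\<close> of the list of vertex \<open>i\<close> and continues with \<open>f\<close> applied to the answer.
  A randomized algorithm is a probability distribution on such trees.  There is no bound on
  computation time and no uniformity in \<open>n\<close>.
\<close>

datatype query_algorithm =
    Output bool
  | Query nat nat "nat set option \<Rightarrow> query_algorithm"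

primrec run :: "(nat \<Rightarrow> nat \<Rightarrow> nat set option) \<Rightarrow> query_algorithm \<Rightarrow> bool" where
  "run orc (Output b) = b"
| "run orc (Query i j f) = run orc (f (orc i j))"

primrec num_queries :: "(nat \<Rightarrow> nat \<Rightarrow> nat set option) \<Rightarrow> query_algorithm \<Rightarrow> nat" where
  "num_queries orc (Output b) = 0"
| "num_queries orc (Query i j f) = Suc (num_queries orc (f (orc i j)))"

definition accept_prob :: "nat \<Rightarrow> nat \<Rightarrow> query_algorithm pmf \<Rightarrow> incidence_lists \<Rightarrow> real" where
  "accept_prob n d T A = measure_pmf.prob T {t. run (answer n d A) t}"

definition tester ::
  "nat \<Rightarrow> nat \<Rightarrow> real \<Rightarrow> hypergraph_property \<Rightarrow> nat \<Rightarrow> query_algorithm pmf \<Rightarrow> bool" where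
  "tester k d \<epsilon> P n T \<longleftrightarrow>
     (\<forall>E A. bounded_degree_input k d n E A \<longrightarrow>
        (P n E \<longrightarrow> accept_prob n d T A \<ge> 2/3) \<and>
        (far_from k d \<epsilon> P n E \<longrightarrow> accept_prob n d T A \<le> 1/3))"

text \<open>
  The worst case is over all inputs of the model and all outcomes of the random choices.  The
  value may be infinite, since a distribution can have infinitely many trees in its support.
\<close>

definition worst_case_queries :: "nat \<Rightarrow> nat \<Rightarrow> nat \<Rightarrow> query_algorithm pmf \<Rightarrow> enat" where
  "worst_case_queries k d n T =
     (SUP A \<in> {A. \<exists>E. bounded_degree_input k d n E A}.
        SUP t \<in> set_pmf T. enat (num_queries (answer n d A) t))"

definition query_complexity ::
  "nat \<Rightarrow> nat \<Rightarrow> real \<Rightarrow> hypergraph_property \<Rightarrow> nat \<Rightarrow> enat" where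
  "query_complexity k d \<epsilon> P n = (INF T \<in> {T. tester k d \<epsilon> P n T}. worst_case_queries k d n T)"

text \<open>
  \<open>g\<close> is \<open>\<Omega>(n)\<close>, for extended naturals, to which the library's \<open>bigomega\<close> does not apply.
\<close>

definition omega_linear :: "(nat \<Rightarrow> enat) \<Rightarrow> bool" where
  "omega_linear g \<longleftrightarrow>
     (\<exists>c>0. \<forall>\<^sub>F n in sequentially. ereal (c * real n) \<le> ereal_of_enat (g n))"

end

theory Submission
  imports Defs
begin

text \<open>
  Fix a system of \<open>k\<close>-variable parity equations over \<open>m\<close> variables and let the \<open>2 * m\<close> literals
  be the vertices.  The hyperedges are the \<open>k\<close>-sets of literals that violate an equation.  A
  solution is an independent set containing half of the vertices.  Conversely, a set \<open>S\<close> of half of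
  the literals touches at least half of the variables; if \<open>S\<close> contains few hyperedges, then some
  assignment satisfies almost all of the equations in these variables, which for random right-hand
  sides and sufficiently many equations is unlikely.  If small sets of equations are expanding,
  then they are linearly independent, as one of them has a private variable.  So an algorithm that
  sees a small linear number of right-hand sides cannot tell uniform ones from the parities of a
  uniformly random assignment.
\<close>

subsection \<open>Decision trees and parities\<close>

text \<open>One left-hand side is fixed for each \<open>n\<close>; only the right-hand sides are
  random. It is found by counting among \<open>C * m\<close> ordered \<open>k\<close>-tuples, and
  two demands compete. Beating the at most \<open>4 ^ m\<close> pairs of a variable set and an
  assignment asks for a large \<open>C\<close>. Expansion asks that sets of up to \<open>q\<close>
  equations span many variables: choosing \<open>s\<close> equations costs about
  \<open>(m / s) ^ s\<close>, while confining them to half of their \<open>k * s\<close> places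
  gains about \<open>(s / m) ^ (k * s / 2)\<close>. The gain wins exactly when \<open>k\<close>
  exceeds 2, and then up to some \<open>q\<close> linear in \<open>m\<close>. The obstacle on the
  query side is that a list of hyperedges could reveal several right-hand sides at once. The lists
  are therefore ordered so that their shape is the same for all right-hand sides and each entry
  depends on one of them. Then the two input distributions give exactly equal acceptance
  probabilities, with no error term. The proximity parameter comes from more than \<open>m\<close>
  violated equations, each with its own hyperedge: this is more than \<open>n / 2\<close> deletions,
  measured against \<open>d * n\<close>.\<close>

definition agrees :: "nat set \<Rightarrow> (nat \<Rightarrow> bool) \<Rightarrow> (nat \<Rightarrow> bool) \<Rightarrow> bool" where
  "agrees F b r \<longleftrightarrow> (\<forall>j\<in>F. r j = b j)"

lemma agrees_insert_upd:
  assumes "c \<notin> F"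
  shows "agrees (insert c F) (b(c := y)) r \<longleftrightarrow> agrees F b r \<and> r c = y"
  using assms by (auto simp: agrees_def)

definition frac :: "'a set \<Rightarrow> ('a \<Rightarrow> bool) \<Rightarrow> real" where
  "frac \<Omega> P = card {w \<in> \<Omega>. P w} / card \<Omega>"

lemma frac_split:
  assumes "finite \<Omega>"
  shows "frac \<Omega> P = frac \<Omega> (\<lambda>w. P w \<and> Q w) + frac \<Omega> (\<lambda>w. P w \<and> \<not> Q w)"
proof -
  have "card {w \<in> \<Omega>. P w} = card ({w \<in> \<Omega>. P w \<and> Q w} \<union> {w \<in> \<Omega>. P w \<and> \<not> Q w})"
    by (rule arg_cong[where f = card]) auto
  also have "\<dots> = card {w \<in> \<Omega>. P w \<and> Q w} + card {w \<in> \<Omega>. P w \<and> \<not> Q w}"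
    using assms by (intro card_Un_disjoint) auto
  finally show ?thesis
    by (simp add: frac_def add_divide_distrib)
qed

text \<open>Induction on the decision tree, where \<open>F\<close> is the set of bits revealed so
  far and \<open>b\<close> their values. The claim concerns the joint event of reaching the current
  subtree and accepting, so that conditional probabilities are avoided. Only at the leaves are the
  marginals on at most \<open>q\<close> bits compared.\<close>

lemma run_frac_eq:
  fixes orc :: "(nat \<Rightarrow> bool) \<Rightarrow> nat \<Rightarrow> nat \<Rightarrow> nat set option"
  assumes fin: "finite \<Omega>" "finite \<Omega>'"
    and marginals: "\<And>F b. F \<subseteq> J \<Longrightarrow> finite F \<Longrightarrow> card F \<le> q \<Longrightarrow>
      frac \<Omega> (\<lambda>w. agrees F b (\<rho> w)) = frac \<Omega>' (\<lambda>w. agrees F b (\<rho>' w))"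
    and local: "\<And>i p. (\<exists>a. \<forall>r. orc r i p = a) \<or> (\<exists>c\<in>J. \<exists>g. \<forall>r. orc r i p = g (r c))"
    and "F \<subseteq> J" "finite F"
    and "\<And>r. agrees F b r \<Longrightarrow> card F + num_queries (orc r) t \<le> q"
  shows "frac \<Omega> (\<lambda>w. agrees F b (\<rho> w) \<and> run (orc (\<rho> w)) t) =
         frac \<Omega>' (\<lambda>w. agrees F b (\<rho>' w) \<and> run (orc (\<rho>' w)) t)"
  using assms(5-)
proof (induction t arbitrary: F b)
  case (Output x)
  have "card F \<le> q"
    using Output.prems(3)[of b] by (simp add: agrees_def)
  then have "frac \<Omega> (\<lambda>w. agrees F b (\<rho> w)) = frac \<Omega>' (\<lambda>w. agrees F b (\<rho>' w))"
    using Output.prems by (intro marginals)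
  then show ?case
    by (cases x) (simp_all add: frac_def)
next
  case (Query i p f)
  show ?case
  \<comment> \<open>In the first case the revealed bits already force the answer, so
    \<open>F\<close> stays as it is; otherwise one new bit joins \<open>F\<close> and the event
    splits by its value.\<close>
  proof (cases "(\<exists>a. \<forall>r. orc r i p = a) \<or> (\<exists>c\<in>F. \<exists>g. \<forall>r. orc r i p = g (r c))")
    case True
    then obtain a where a: "orc r i p = a" if "agrees F b r" for r
      by (auto simp: agrees_def)
    have "frac \<Omega> (\<lambda>w. agrees F b (\<rho> w) \<and> run (orc (\<rho> w)) (f a)) =
          frac \<Omega>' (\<lambda>w. agrees F b (\<rho>' w) \<and> run (orc (\<rho>' w)) (f a))"
    proof (rule Query.IH[OF _ Query.prems(1,2)])
      fix r assume "agrees F b r"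
      then show "card F + num_queries (orc r) (f a) \<le> q"
        using Query.prems(3)[of r] a[of r] by simp
    qed simp
    moreover have "(agrees F b r \<and> run (orc r) (Query i p f)) = (agrees F b r \<and> run (orc r) (f a))" for r
      using a[of r] by auto
    ultimately show ?thesis
      by simp
  next
    case False
    with local[of i p] obtain c g where c: "c \<in> J" "c \<notin> F" and g: "\<And>r. orc r i p = g (r c)"
      by blast
    have step: "frac \<Omega> (\<lambda>w. agrees (insert c F) (b(c := y)) (\<rho> w) \<and> run (orc (\<rho> w)) (f (g y))) =
          frac \<Omega>' (\<lambda>w. agrees (insert c F) (b(c := y)) (\<rho>' w) \<and> run (orc (\<rho>' w)) (f (g y)))" for y
    proof (rule Query.IH)
      fix r assume r: "agrees (insert c F) (b(c := y)) r"
      then have "agrees F b r" "r c = y"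
        using c by (auto simp: agrees_insert_upd)
      then show "card (insert c F) + num_queries (orc r) (f (g y)) \<le> q"
        using Query.prems(2) Query.prems(3)[of r] c g[of r] by simp
    qed (use c Query.prems in auto)
    have eq: "(agrees (insert c F) (b(c := y)) r \<and> run (orc r) (f (g y))) =
        ((agrees F b r \<and> run (orc r) (Query i p f)) \<and> r c = y)" for r y
      using c by (auto simp: agrees_insert_upd g)
    show ?thesis
      using step[of True] step[of False]
        frac_split[OF fin(1), of "\<lambda>w. agrees F b (\<rho> w) \<and> run (orc (\<rho> w)) (Query i p f)" "\<lambda>w. \<rho> w c"]
        frac_split[OF fin(2), of "\<lambda>w. agrees F b (\<rho>' w) \<and> run (orc (\<rho>' w)) (Query i p f)" "\<lambda>w. \<rho>' w c"]
      unfolding eq by simp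
  qed
qed

lemma frac_agrees_uniform:
  assumes "F \<subseteq> {..<N}"
  shows "frac ({..<N} \<rightarrow>\<^sub>E (UNIV :: bool set)) (agrees F b) = 1 / 2 ^ card F"
proof -
  have [simp]: "finite F"
    using assms finite_subset by blast
  have "{r \<in> {..<N} \<rightarrow>\<^sub>E UNIV. agrees F b r} = (\<Pi>\<^sub>E j\<in>{..<N}. if j \<in> F then {b j} else UNIV)"
    using assms by (fastforce simp: agrees_def PiE_iff split: if_splits)
  then have "card {r \<in> {..<N} \<rightarrow>\<^sub>E UNIV. agrees F b r} =
      (\<Prod>j<N. card (if j \<in> F then {b j} else (UNIV :: bool set)))"
    by (simp add: card_PiE)
  also have "\<dots> = (\<Prod>j<N. if j \<in> {..<N} - F then 2 else 1)"
    by (intro prod.cong) auto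
  also have "\<dots> = 2 ^ card ({..<N} - F)"
    by (simp add: prod.If_cases Int_def set_diff_eq)
  also have "card ({..<N} - F) = N - card F"
    using assms by (simp add: card_Diff_subset)
  finally have "card {r \<in> {..<N} \<rightarrow>\<^sub>E UNIV. agrees F b r} = 2 ^ (N - card F)" .
  moreover have "card F \<le> N"
    using card_mono[OF _ assms] by simp
  then have "(2 :: real) ^ N = 2 ^ (N - card F) * 2 ^ card F"
    by (simp flip: power_add)
  ultimately show ?thesis
    by (simp add: frac_def card_PiE)
qed

section \<open>Independence of parities from expansion\<close>

text \<open>Double counting: if every vertex of the union lay in two of the sets, there would be at
  least twice as many incidences as vertices, but there are only \<open>k * card F\<close>.\<close>

lemma private_vertex:
  assumes "finite F" and card_e: "\<And>j. j \<in> F \<Longrightarrow> card (e j) = k"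
    and fin: "\<And>j. j \<in> F \<Longrightarrow> finite (e j)"
    and "k * card F < 2 * card (\<Union>j\<in>F. e j)"
  shows "\<exists>j\<in>F. \<exists>v\<in>e j. \<forall>j'\<in>F. v \<in> e j' \<longrightarrow> j' = j"
proof (rule ccontr)
  assume neg: "\<not> ?thesis"
  let ?U = "\<Union>j\<in>F. e j"
  have ge: "2 \<le> card {j \<in> F. v \<in> e j}" if v: "v \<in> ?U" for v
  proof -
    from v obtain j where j: "j \<in> F" "v \<in> e j"
      by blast
    with neg obtain j' where "j' \<in> F" "v \<in> e j'" "j' \<noteq> j"
      by blast
    with j \<open>finite F\<close> have "card {j, j'} \<le> card {j \<in> F. v \<in> e j}"
      by (intro card_mono) auto
    with \<open>j' \<noteq> j\<close> show ?thesis
      by simp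
  qed
  have "2 * card ?U = (\<Sum>v\<in>?U. 2)"
    by simp
  also have "\<dots> \<le> (\<Sum>v\<in>?U. card {j \<in> F. v \<in> e j})"
    by (intro sum_mono ge)
  also have "\<dots> = (\<Sum>j\<in>F. card {v \<in> ?U. v \<in> e j})"
    using \<open>finite F\<close> fin by (intro sum_multicount_gen) auto
  also have "\<dots> = (\<Sum>j\<in>F. k)"
  proof (rule sum.cong)
    fix j assume "j \<in> F"
    moreover from this have "{v \<in> ?U. v \<in> e j} = e j"
      by blast
    ultimately show "card {v \<in> ?U. v \<in> e j} = k"
      using card_e by simp
  qed simp
  finally show False
    using assms by (simp add: mult.commute)
qed

definition parity :: "(nat \<Rightarrow> nat set) \<Rightarrow> nat set \<Rightarrow> nat \<Rightarrow> bool" where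
  "parity e X j = odd (card (X \<inter> e j))"

definition flip :: "nat \<Rightarrow> nat set \<Rightarrow> nat set" where
  "flip v X = (if v \<in> X then X - {v} else insert v X)"

lemma flip_flip [simp]: "flip v (flip v X) = X"
  by (auto simp: flip_def)

lemma parity_flip:
  assumes "finite (e j)"
  shows "parity e (flip v X) j = (if v \<in> e j then \<not> parity e X j else parity e X j)"
proof -
  have fin: "finite (X \<inter> e j)"
    using assms by simp
  consider "v \<notin> e j" | "v \<in> e j" "v \<in> X" | "v \<in> e j" "v \<notin> X"
    by blast
  then show ?thesis
  proof cases
    case 1
    then have "flip v X \<inter> e j = X \<inter> e j"
      by (auto simp: flip_def)
    with 1 show ?thesis
      by (simp add: parity_def)
  next
    case 2
    then have "X \<inter> e j = insert v (flip v X \<inter> e j)" "v \<notin> flip v X \<inter> e j"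
      by (auto simp: flip_def)
    with fin have "card (X \<inter> e j) = Suc (card (flip v X \<inter> e j))"
      by (metis card_insert_disjoint finite_insert)
    with 2 show ?thesis
      by (simp add: parity_def)
  next
    case 3
    then have "flip v X \<inter> e j = insert v (X \<inter> e j)" "v \<notin> X \<inter> e j"
      by (auto simp: flip_def)
    with fin have "card (flip v X \<inter> e j) = Suc (card (X \<inter> e j))"
      by simp
    with 3 show ?thesis
      by (simp add: parity_def)
  qed
qed

text \<open>Induction on \<open>card F\<close>, removing an equation \<open>j\<close> with a private
  variable \<open>v\<close>. Flipping \<open>v\<close> is an involution on assignments that reverses
  the parity of \<open>j\<close> and keeps all the others, so it matches the two values of that
  parity and each condition halves the count. This replaces a rank argument over the field with two
  elements.\<close>

lemma frac_agrees_parity: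
  assumes "finite V"
    and e: "\<And>j. j \<in> J \<Longrightarrow> e j \<subseteq> V \<and> card (e j) = k"
    and expanding: "\<And>F. F \<subseteq> J \<Longrightarrow> finite F \<Longrightarrow> F \<noteq> {} \<Longrightarrow> card F \<le> q \<Longrightarrow> k * card F < 2 * card (\<Union>j\<in>F. e j)"
    and "finite F" "F \<subseteq> J" "card F \<le> q"
  shows "frac (Pow V) (\<lambda>X. agrees F b (parity e X)) = 1 / 2 ^ card F"
  using assms(4-)
proof (induction "card F" arbitrary: F b)
  case 0
  then show ?case
    using \<open>finite V\<close> card_Pow[of V] by (simp add: frac_def agrees_def Pow_def)
next
  case (Suc s)
  have fin: "finite (e j)" if "j \<in> J" for j
    using that e \<open>finite V\<close> finite_subset by blast
  have "k * card F < 2 * card (\<Union>j\<in>F. e j)"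
    using Suc by (intro expanding) auto
  then obtain j v where j: "j \<in> F" "v \<in> e j" and priv: "\<And>j'. j' \<in> F \<Longrightarrow> v \<in> e j' \<Longrightarrow> j' = j"
    using private_vertex[of F e k] Suc.prems e fin by blast
  define G where "G = F - {j}"
  have G: "F = insert j G" "j \<notin> G" "finite G" "card G = s" "G \<subseteq> J"
    using j Suc by (auto simp: G_def)
  have "v \<in> V"
    using j e Suc.prems by blast
  let ?A = "\<lambda>y. {X \<in> Pow V. agrees G b (parity e X) \<and> parity e X j = y}"
  have flip_mem: "flip v X \<in> ?A (\<not> y)" if "X \<in> ?A y" for X y
  proof -
    have "parity e (flip v X) i = parity e X i" if "i \<in> G" for i
    proof -
      have "v \<notin> e i"
        using priv[of i] that G by auto
      then show ?thesis
        using parity_flip[of e i v X] fin[of i] that G by auto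
    qed
    moreover have "parity e (flip v X) j = (\<not> parity e X j)"
      using parity_flip[of e j v X] fin[of j] j Suc.prems by auto
    moreover have "flip v X \<subseteq> V"
      using that \<open>v \<in> V\<close> by (auto simp: flip_def)
    ultimately show ?thesis
      using that by (auto simp: agrees_def)
  qed
  have "bij_betw (flip v) (?A (b j)) (?A (\<not> b j))"
    by (rule bij_betw_byWitness[where f' = "flip v"]) (use flip_mem[of _ "b j"] flip_mem[of _ "\<not> b j"] in auto)
  then have "frac (Pow V) (\<lambda>X. agrees G b (parity e X) \<and> parity e X j = (\<not> b j)) =
      frac (Pow V) (\<lambda>X. agrees G b (parity e X) \<and> parity e X j = b j)"
    by (simp add: frac_def bij_betw_same_card)
  moreover have "frac (Pow V) (\<lambda>X. agrees G b (parity e X)) = 1 / 2 ^ s"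
    using Suc.hyps(1)[of G] G Suc by simp
  moreover have "agrees F b r \<longleftrightarrow> agrees G b r \<and> r j = b j" for r
    using G by (auto simp: agrees_def)
  ultimately show ?case
    using frac_split[of "Pow V" "\<lambda>X. agrees G b (parity e X)" "\<lambda>X. parity e X j = b j"] \<open>finite V\<close>
    by (simp flip: Suc.hyps(2) cong: conj_cong)
qed

subsection \<open>Random equations: expansion\<close>

text \<open>A weak Stirling bound: consecutive quotients of \<open>s ^ s / fact s\<close> are
  \<open>(1 + 1 / s) ^ s\<close>, which is at most \<open>exp 1\<close> and hence at most 3.\<close>

lemma power_self_le_fact: "real s ^ s \<le> 3 ^ s * fact s"
proof (induction s)
  case (Suc s)
  show ?case
  proof (cases "s = 0")
    case False
    have "(1 + 1 / real s) ^ s \<le> 3"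
      using exp_ge_one_plus_x_over_n_power_n[of s 1] exp_le False by simp
    then have "real s ^ s * (1 + 1 / real s) ^ s \<le> (3 ^ s * fact s) * 3"
      by (intro mult_mono Suc.IH) auto
    moreover have "real s ^ s * (1 + 1 / real s) ^ s = real (Suc s) ^ s"
      using False by (simp add: field_simps flip: power_mult_distrib)
    ultimately have "real (Suc s) ^ s * real (Suc s) \<le> ((3 ^ s * fact s) * 3) * real (Suc s)"
      by (intro mult_right_mono) simp_all
    then show ?thesis
      by (simp add: algebra_simps)
  qed simp
qed simp

text \<open>The usual bound \<open>(3 * n / s) ^ s\<close> for a binomial coefficient, freed of
  division so that \<open>s = 0\<close> needs no exception.\<close>

lemma binomial_mult_power_le: "real (n choose s) * real s ^ s \<le> (3 * real n) ^ s"
proof -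
  have "real (n choose s) * real s ^ s \<le> real (n choose s) * (3 ^ s * fact s)"
    by (intro mult_left_mono power_self_le_fact) simp
  also have "\<dots> = 3 ^ s * real ((n choose s) * fact s)"
    by simp
  also have "\<dots> \<le> 3 ^ s * real (n ^ s)"
    by (intro mult_left_mono of_nat_mono binomial_fact_pow) simp
  finally show ?thesis
    by (simp add: power_mult_distrib)
qed

text \<open>One term of the union bound: choose \<open>s\<close> equations and \<open>h\<close>
  variables, then confine all \<open>k * s\<close> places to these variables. With
  \<open>y = s / m\<close> the first choice costs \<open>(3 * C / y) ^ s\<close>, and the rest
  contributes at most \<open>z ^ (L - h)\<close> with \<open>z\<close> proportional to
  \<open>y\<close>. Since \<open>L - h\<close> is at least \<open>3 * s / 2\<close>, which uses
  \<open>k \<ge> 3\<close>, a factor of order \<open>y ^ (s / 2)\<close> survives. The constant is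
  \<open>1944 = 64 * 9 * 27 / 8\<close>: the 9 and \<open>27 / 8\<close> come from squaring
  \<open>3 * C / y\<close> and cubing \<open>z\<close>, the 64 from the target \<open>1 / 8\<close>
  squared.\<close>

lemma nonexpanding_term_le:
  fixes k C s m :: nat
  assumes k: "k \<ge> 3" and C: "C \<ge> 1" and s: "s \<ge> 1" and small: "s * (1944 * C\<^sup>2 * k ^ 3) \<le> m"
  defines "h \<equiv> k * s div 2"
  shows "real ((C * m) choose s) * real (m choose h) * real h ^ (k * s) \<le> (1/8) ^ s * real m ^ (k * s)"
proof -
  define L where "L = k * s"
  define y where "y = real s / real m"
  define z where "z = 3 * real k * y / 2"
  have pos: "1944 * C\<^sup>2 * k ^ 3 > 0"
    using k C by simp
  have m: "m > 0"
    using mult_pos_pos[of s "1944 * C\<^sup>2 * k ^ 3"] pos small s by linarith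
  have y: "y > 0"
    using s m by (simp add: y_def)
  have "real (s * (1944 * C\<^sup>2 * k ^ 3)) \<le> real m"
    using small by (rule of_nat_mono)
  then have small_y: "y * (1944 * real C ^ 2 * real k ^ 3) \<le> 1"
    using m by (simp add: y_def field_simps)
  have z0: "z \<ge> 0"
    using y by (simp add: z_def)
  have "1 * real k ^ 1 \<le> real C ^ 2 * real k ^ 3"
    using k C by (intro mult_mono power_increasing) auto
  then have "3 * real k / 2 \<le> 1944 * real C ^ 2 * real k ^ 3"
    by simp
  then have "y * (3 * real k / 2) \<le> y * (1944 * real C ^ 2 * real k ^ 3)"
    using y by (intro mult_left_mono; simp)
  then have "y * (3 * real k / 2) \<le> 1"
    using small_y by linarith
  then have z1: "z \<le> 1"
    by (simp add: z_def mult_ac)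
  have hL: "h \<le> L" "2 * (L - h) \<ge> L" "L - h \<ge> h" "2 * h \<le> L" "L \<ge> 3 * s"
    using k by (auto simp: L_def h_def)
  have zh: "3 * real h \<le> z * real m"
  proof -
    have "2 * real h \<le> real k * real s"
      using hL(4) by (simp add: L_def flip: of_nat_mult)
    then show ?thesis
      using m by (simp add: z_def y_def)
  qed
  have "real (m choose h) * real h ^ L = (real (m choose h) * real h ^ h) * real h ^ (L - h)"
    using hL by (simp flip: power_add)
  also have "\<dots> \<le> (3 * real m) ^ h * real h ^ (L - h)"
    by (intro mult_right_mono binomial_mult_power_le) simp
  also have "\<dots> = (real m ^ h * real h ^ (L - h)) * 3 ^ h"
    by (simp add: power_mult_distrib)
  \<comment> \<open>As \<open>h \<le> L - h\<close>, raising the exponent of 3 lets it merge with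
    the power of \<open>h\<close>.\<close>
  also have "\<dots> \<le> (real m ^ h * real h ^ (L - h)) * 3 ^ (L - h)"
    using hL by (intro mult_left_mono power_increasing) auto
  also have "\<dots> = real m ^ h * (3 * real h) ^ (L - h)"
    by (simp add: power_mult_distrib)
  also have "\<dots> \<le> real m ^ h * (z * real m) ^ (L - h)"
    by (intro mult_left_mono power_mono zh) auto
  also have "\<dots> = z ^ (L - h) * real m ^ L"
    using hL by (simp add: power_mult_distrib flip: power_add)
  finally have part1: "real (m choose h) * real h ^ L \<le> z ^ (L - h) * real m ^ L" .
  have "real ((C * m) choose s) * real s ^ s \<le> (3 * real C * real m) ^ s"
    using binomial_mult_power_le[of "C * m" s] by (simp add: mult.assoc)
  then have part2: "real ((C * m) choose s) \<le> (3 * real C / y) ^ s"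
    using s m by (simp add: y_def field_simps)
  \<comment> \<open>Squaring avoids the half-integral exponent \<open>3 * s / 2\<close>.\<close>
  have "((3 * real C / y) ^ s * z ^ (L - h))\<^sup>2 = ((3 * real C / y)\<^sup>2) ^ s * z ^ (2 * (L - h))"
    by (simp add: power_mult_distrib mult.commute flip: power_mult)
  also have "\<dots> \<le> ((3 * real C / y)\<^sup>2) ^ s * z ^ (3 * s)"
    using hL z0 z1 by (intro mult_left_mono power_decreasing) auto
  also have "\<dots> = ((3 * real C / y)\<^sup>2 * z ^ 3) ^ s"
    by (simp add: power_mult_distrib power_mult)
  also have "(3 * real C / y)\<^sup>2 * z ^ 3 = (y * (1944 * real C ^ 2 * real k ^ 3)) / 64"
    using y by (simp add: z_def power2_eq_square power3_eq_cube field_simps)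
  also have "\<dots> ^ s \<le> (1 / 64) ^ s"
    using small_y y by (intro power_mono) auto
  also have "\<dots> = ((1 / 8) ^ s)\<^sup>2"
    by (simp add: power2_eq_square flip: power_mult_distrib)
  finally have "(3 * real C / y) ^ s * z ^ (L - h) \<le> (1 / 8) ^ s"
    by (rule power2_le_imp_le) simp
  moreover have "real ((C * m) choose s) * (real (m choose h) * real h ^ L)
      \<le> (3 * real C / y) ^ s * (z ^ (L - h) * real m ^ L)"
    by (rule mult_mono[OF part2 part1]) (use y in \<open>simp_all add: less_imp_le\<close>)
  moreover have "(3 * real C / y) ^ s * z ^ (L - h) * real m ^ L \<le> (1 / 8) ^ s * real m ^ L"
    using calculation(1) by (intro mult_right_mono) simp_all
  ultimately show ?thesis
    unfolding L_def by (simp only: mult.assoc)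
qed

section \<open>Union bound for expansion\<close>

text \<open>Repetitions are allowed so that the \<open>k\<close> places are independent and all
  counts are plain powers; equations with a repeated variable are discarded at the end.\<close>

definition tuples :: "nat \<Rightarrow> 'a set \<Rightarrow> 'a list set" where
  "tuples k V = {xs. set xs \<subseteq> V \<and> length xs = k}"

lemma finite_tuples [simp]: "finite V \<Longrightarrow> finite (tuples k V)"
  unfolding tuples_def by (rule finite_lists_length_eq)

lemma card_tuples: "finite V \<Longrightarrow> card (tuples k V) = card V ^ k"
  unfolding tuples_def by (rule card_lists_length_eq)

lemma card_confined:
  assumes "finite V" "U \<subseteq> V" "F \<subseteq> {..<N}"
  shows "card {e \<in> {..<N} \<rightarrow>\<^sub>E tuples k V. \<forall>j\<in>F. set (e j) \<subseteq> U} =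
         card U ^ (k * card F) * card V ^ (k * (N - card F))"
proof -
  have [simp]: "finite U" "finite F"
    using assms finite_subset by blast+
  have "{e \<in> {..<N} \<rightarrow>\<^sub>E tuples k V. \<forall>j\<in>F. set (e j) \<subseteq> U} =
      (\<Pi>\<^sub>E j\<in>{..<N}. tuples k (if j \<in> F then U else V))"
    using assms(2,3) by (intro set_eqI iffI; simp add: PiE_iff tuples_def split: if_splits; blast)
  then have "card {e \<in> {..<N} \<rightarrow>\<^sub>E tuples k V. \<forall>j\<in>F. set (e j) \<subseteq> U} =
      (\<Prod>j<N. if j \<in> F then card U ^ k else card V ^ k)"
    using assms by (simp add: card_PiE card_tuples if_distrib cong: if_cong)
  also have "\<dots> = (card U ^ k) ^ card F * (card V ^ k) ^ card ({..<N} - F)"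
  proof -
    have "{..<N} \<inter> {j. j \<in> F} = F" "{..<N} \<inter> - {j. j \<in> F} = {..<N} - F"
      using assms by auto
    then show ?thesis
      by (simp add: prod.If_cases)
  qed
  also have "card ({..<N} - F) = N - card F"
    using assms by (simp add: card_Diff_subset)
  finally show ?thesis
    by (simp add: power_mult)
qed

definition nonexpanding :: "nat \<Rightarrow> nat \<Rightarrow> nat \<Rightarrow> 'a set \<Rightarrow> (nat \<Rightarrow> 'a list) set" where
  "nonexpanding k N s V = {e \<in> {..<N} \<rightarrow>\<^sub>E tuples k V.
     \<exists>F\<subseteq>{..<N}. card F = s \<and> 2 * card (\<Union>j\<in>F. set (e j)) \<le> k * s}"

text \<open>Union bound over the equations \<open>F\<close> and over sets \<open>U\<close> that
  contain their variables. A smaller union is padded to size exactly \<open>k * s div 2\<close>, for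
  which \<open>V\<close> has to be large enough.\<close>

lemma card_nonexpanding_le:
  assumes "finite V" and h: "k * s div 2 \<le> card V"
  shows "card (nonexpanding k N s V) \<le> (N choose s) * (card V choose (k * s div 2)) *
    ((k * s div 2) ^ (k * s) * card V ^ (k * (N - s)))"
proof -
  let ?h = "k * s div 2"
  let ?Fs = "{F. F \<subseteq> {..<N} \<and> card F = s}" and ?Us = "{U. U \<subseteq> V \<and> card U = ?h}"
  let ?A = "\<lambda>F U. {e \<in> {..<N} \<rightarrow>\<^sub>E tuples k V. \<forall>j\<in>F. set (e j) \<subseteq> U}"
  have sub: "nonexpanding k N s V \<subseteq> (\<Union>(F, U)\<in>?Fs \<times> ?Us. ?A F U)"
  proof
    fix e assume "e \<in> nonexpanding k N s V"
    then obtain F where e: "e \<in> {..<N} \<rightarrow>\<^sub>E tuples k V" and F: "F \<subseteq> {..<N}" "card F = s"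
      and *: "2 * card (\<Union>j\<in>F. set (e j)) \<le> k * s"
      by (auto simp: nonexpanding_def)
    have "(\<Union>j\<in>F. set (e j)) \<subseteq> V"
      using e F by (fastforce simp: PiE_iff tuples_def)
    moreover have "card (\<Union>j\<in>F. set (e j)) \<le> ?h"
      using * by simp
    ultimately obtain U where "(\<Union>j\<in>F. set (e j)) \<subseteq> U" "U \<subseteq> V" "card U = ?h"
      using h \<open>finite V\<close> exists_subset_between[of "\<Union>j\<in>F. set (e j)" ?h V] by blast
    with e F show "e \<in> (\<Union>(F, U)\<in>?Fs \<times> ?Us. ?A F U)"
      by blast
  qed
  have fin: "finite (?Fs \<times> ?Us)"
    using \<open>finite V\<close> by simp
  have fin': "finite ({..<N} \<rightarrow>\<^sub>E tuples k V)"
    using \<open>finite V\<close> by (intro finite_PiE) auto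
  have "card (nonexpanding k N s V) \<le> card (\<Union>(F, U)\<in>?Fs \<times> ?Us. ?A F U)"
    using sub fin fin' by (intro card_mono finite_UN_I) auto
  also have "\<dots> \<le> (\<Sum>(F, U)\<in>?Fs \<times> ?Us. card (?A F U))"
    using card_UN_le[OF fin] by (simp add: case_prod_unfold)
  also have "\<dots> = (\<Sum>(F, U)\<in>?Fs \<times> ?Us. ?h ^ (k * s) * card V ^ (k * (N - s)))"
    using \<open>finite V\<close> by (intro sum.cong refl) (auto simp: card_confined)
  also have "\<dots> = (N choose s) * (card V choose ?h) * (?h ^ (k * s) * card V ^ (k * (N - s)))"
    using \<open>finite V\<close> by (simp add: card_cartesian_product n_subsets)
  finally show ?thesis .
qed

lemma card_nonexpanding_small:
  fixes k C s m :: nat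
  assumes k: "k \<ge> 3" and C: "C \<ge> 1" and s: "s \<ge> 1" and small: "s * (1944 * C\<^sup>2 * k ^ 3) \<le> m"
    and V: "finite V" "card V = m"
  shows "real (card (nonexpanding k (C * m) s V)) \<le> (1/8) ^ s * real m ^ (k * (C * m))"
proof -
  have kC: "k \<le> 1944 * C\<^sup>2 * k ^ 3" "1 \<le> 1944 * C\<^sup>2 * k ^ 3"
  proof -
    have "1 * k ^ 1 \<le> (1944 * C\<^sup>2) * k ^ 3"
      using k C by (intro mult_mono power_increasing) auto
    then show "k \<le> 1944 * C\<^sup>2 * k ^ 3"
      by simp
    with k show "1 \<le> 1944 * C\<^sup>2 * k ^ 3"
      by linarith
  qed
  have "s * k \<le> m" "s * 1 \<le> m"
    using small kC by (meson le_trans mult_le_mono2)+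
  moreover have "1 * m \<le> C * m"
    using C by (intro mult_right_mono) auto
  ultimately have le: "k * s div 2 \<le> m" "s \<le> C * m"
    using mult.commute[of k s] by linarith+
  let ?h = "k * s div 2"
  have "real (card (nonexpanding k (C * m) s V)) \<le>
      real (((C * m) choose s) * (m choose ?h) * (?h ^ (k * s) * m ^ (k * (C * m - s))))"
    using card_nonexpanding_le[of V k s "C * m"] V le by (intro of_nat_mono) simp
  also have "\<dots> = (real ((C * m) choose s) * real (m choose ?h) * real ?h ^ (k * s)) * real m ^ (k * (C * m - s))"
    by simp
  also have "\<dots> \<le> ((1/8) ^ s * real m ^ (k * s)) * real m ^ (k * (C * m - s))"
    by (intro mult_right_mono nonexpanding_term_le assms) simp
  also have "\<dots> = (1/8) ^ s * real m ^ (k * s + k * (C * m - s))"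
    by (simp add: power_add)
  also have "k * s + k * (C * m - s) = k * (C * m)"
    using le by (simp flip: add_mult_distrib2)
  finally show ?thesis .
qed

lemma sum_eighth_le: "(\<Sum>s=1..S. (1/8 :: real) ^ s) \<le> 1 / 7"
proof -
  have "(\<Sum>s=1..S. (1/8 :: real) ^ s) = (1 - (1/8) ^ S) / 7"
  proof (induction S)
    case (Suc S)
    define a :: real where "a = (1/8) ^ S"
    have a: "(1/8 :: real) ^ Suc S = a / 8"
      by (simp add: a_def)
    have "(\<Sum>s=1..Suc S. (1/8 :: real) ^ s) = (1 - a) / 7 + a / 8"
      using Suc a by (simp add: a_def)
    also have "\<dots> = (1 - a / 8) / 7"
      by (simp add: field_simps)
    finally show ?case
      unfolding a .
  qed simp
  then show ?thesis
    by simp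
qed

lemma card_nonexpanding_Union:
  fixes k C S m :: nat
  assumes k: "k \<ge> 3" and C: "C \<ge> 1" and small: "S * (1944 * C\<^sup>2 * k ^ 3) \<le> m"
    and V: "finite V" "card V = m"
  shows "real (card (\<Union>s\<in>{1..S}. nonexpanding k (C * m) s V)) \<le> real m ^ (k * (C * m)) / 7"
proof -
  have "real (card (\<Union>s\<in>{1..S}. nonexpanding k (C * m) s V)) \<le>
      real (\<Sum>s=1..S. card (nonexpanding k (C * m) s V))"
    by (intro of_nat_mono card_UN_le) simp
  also have "\<dots> \<le> (\<Sum>s=1..S. (1/8) ^ s * real m ^ (k * (C * m)))"
    unfolding of_nat_sum
  proof (intro sum_mono card_nonexpanding_small assms)
    fix s assume "s \<in> {1..S}"
    then show "s * (1944 * C\<^sup>2 * k ^ 3) \<le> m" "s \<ge> 1"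
      using small by (auto intro: order_trans[OF mult_right_mono])
  qed
  also have "\<dots> = (\<Sum>s=1..S. (1/8) ^ s) * real m ^ (k * (C * m))"
    by (simp add: sum_distrib_right)
  also have "\<dots> \<le> 1 / 7 * real m ^ (k * (C * m))"
    by (intro mult_right_mono sum_eighth_le) simp
  finally show ?thesis
    by simp
qed

subsection \<open>Random equations: unsatisfiability\<close>

text \<open>An exponential moment bound: the indicator of at most \<open>t\<close> hits is at most
  \<open>2 ^ t\<close> times a factor \<open>1/2\<close> per hit, and this product factorises over
  the independent coordinates.\<close>

lemma sum_card_few_hits_le:
  fixes P :: "'a \<Rightarrow> bool \<Rightarrow> bool"
  assumes "finite T"
  shows "(\<Sum>e\<in>{..<N} \<rightarrow>\<^sub>E T. real (card {r \<in> {..<N} \<rightarrow>\<^sub>E UNIV. card {j \<in> {..<N}. P (e j) (r j)} \<le> t}))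
    \<le> 2 ^ t * (\<Sum>x\<in>T. \<Sum>b\<in>UNIV. if P x b then 1/2 else 1) ^ N"
proof -
  let ?R = "{..<N} \<rightarrow>\<^sub>E (UNIV :: bool set)"
  let ?w = "\<lambda>x b. if P x b then 1/2 else 1 :: real"
  have fin: "finite ?R"
    by (intro finite_PiE) auto
  have "real (card {r \<in> ?R. card {j \<in> {..<N}. P (e j) (r j)} \<le> t}) \<le> 2 ^ t * (\<Prod>j<N. \<Sum>b\<in>UNIV. ?w (e j) b)" for e
  proof -
    have "real (card {r \<in> ?R. card {j \<in> {..<N}. P (e j) (r j)} \<le> t}) =
        (\<Sum>r\<in>?R. if card {j \<in> {..<N}. P (e j) (r j)} \<le> t then 1 else 0)"
      using fin by (simp add: sum.If_cases Int_def)
    also have "\<dots> \<le> (\<Sum>r\<in>?R. 2 ^ t * (\<Prod>j<N. ?w (e j) (r j)))"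
    proof (rule sum_mono)
      fix r :: "nat \<Rightarrow> bool"
      let ?x = "card {j \<in> {..<N}. P (e j) (r j)}"
      have "(\<Prod>j<N. ?w (e j) (r j)) = (1/2) ^ ?x"
        by (simp add: prod.If_cases Int_def)
      moreover have "(1 :: real) \<le> 2 ^ t * (1/2) ^ ?x" if "?x \<le> t"
      proof -
        have "(2 :: real) ^ ?x \<le> 2 ^ t"
          using that by (intro power_increasing) auto
        then show ?thesis
          by (simp add: power_divide)
      qed
      ultimately show "(if ?x \<le> t then 1 else 0) \<le> 2 ^ t * (\<Prod>j<N. ?w (e j) (r j))"
        by simp
    qed
    also have "\<dots> = 2 ^ t * (\<Prod>j<N. \<Sum>b\<in>UNIV. ?w (e j) b)"
      by (subst prod_sum_PiE) (auto simp: sum_distrib_left)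
    finally show ?thesis .
  qed
  then have "(\<Sum>e\<in>{..<N} \<rightarrow>\<^sub>E T. real (card {r \<in> ?R. card {j \<in> {..<N}. P (e j) (r j)} \<le> t}))
      \<le> (\<Sum>e\<in>{..<N} \<rightarrow>\<^sub>E T. 2 ^ t * (\<Prod>j<N. \<Sum>b\<in>UNIV. ?w (e j) b))"
    by (rule sum_mono)
  also have "\<dots> = 2 ^ t * (\<Prod>j<N. \<Sum>x\<in>T. \<Sum>b\<in>UNIV. ?w x b)"
    using assms by (subst prod_sum_PiE) (auto simp: sum_distrib_left)
  finally show ?thesis
    by simp
qed

text \<open>From \<open>8 * k \<le> m\<close> and \<open>m \<le> 4 * card W\<close>, each of the
  \<open>k\<close> factors of the falling factorial is at least \<open>m / 8\<close>.\<close>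

lemma card_distinct_tuples_ge:
  assumes "finite W" "m \<le> 4 * card W" "8 * k \<le> m"
  shows "m ^ k \<le> 8 ^ k * card {xs \<in> tuples k W. distinct xs}"
proof -
  have k: "k \<le> card W"
    using assms by simp
  have "m ^ k \<le> (8 * (card W - k + 1)) ^ k"
    using assms by (intro power_mono) auto
  also have "\<dots> = 8 ^ k * (\<Prod>i\<in>{card W - k + 1..card W}. card W - k + 1)"
    using k by (subst power_mult_distrib) simp
  also have "\<dots> \<le> 8 ^ k * \<Prod>{card W - k + 1..card W}"
    by (intro mult_left_mono prod_mono) auto
  also have "\<Prod>{card W - k + 1..card W} = card {xs. length xs = k \<and> distinct xs \<and> set xs \<subseteq> W}"
    using card_lists_distinct_length_eq[OF \<open>finite W\<close> k] by simp
  also have "{xs. length xs = k \<and> distinct xs \<and> set xs \<subseteq> W} = {xs \<in> tuples k W. distinct xs}"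
    by (auto simp: tuples_def)
  finally show ?thesis .
qed

definition violated :: "nat set \<Rightarrow> nat set \<Rightarrow> nat list \<Rightarrow> bool \<Rightarrow> bool" where
  "violated W a xs b \<longleftrightarrow> distinct xs \<and> set xs \<subseteq> W \<and> b \<noteq> odd (card (a \<inter> set xs))"

text \<open>The assignment \<open>a\<close> is the set of its true variables in \<open>W\<close>. A
  quarter of the variables is enough for \<open>W\<close>, although an independent set will touch
  half of them: another quarter may be lost to variables of high degree.\<close>

definition nearly_satisfiable :: "nat \<Rightarrow> nat \<Rightarrow> nat set \<Rightarrow> (nat \<Rightarrow> nat list) \<Rightarrow> (nat \<Rightarrow> bool) set" where
  "nearly_satisfiable N t V e = {r \<in> {..<N} \<rightarrow>\<^sub>E UNIV. \<exists>W a. a \<subseteq> W \<and> W \<subseteq> V \<and> card V \<le> 4 * card W \<and>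
     card {j \<in> {..<N}. violated W a (e j) (r j)} \<le> t}"

text \<open>For a tuple of distinct variables of \<open>W\<close> exactly one of the two right-hand
  sides is violated, which lowers its weight from 2 to \<open>3/2\<close>. Such tuples make up at
  least a fraction \<open>1 / 8 ^ k\<close>.\<close>

lemma sum_violated_weights_le:
  assumes "finite V" "W \<subseteq> V" "card V \<le> 4 * card W" "8 * k \<le> card V"
  shows "(\<Sum>x\<in>tuples k V. \<Sum>b\<in>UNIV. if violated W a x b then 1/2 else 1)
    \<le> 2 * real (card V) ^ k * (1 - 1 / (4 * 8 ^ k))"
proof -
  let ?D = "{xs \<in> tuples k W. distinct xs}"
  have fin: "finite W"
    using assms finite_subset by blast
  have D: "tuples k V \<inter> {x. distinct x \<and> set x \<subseteq> W} = ?D"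
    using assms by (auto simp: tuples_def)
  have "(\<Sum>x\<in>tuples k V. \<Sum>b\<in>UNIV. if violated W a x b then 1/2 else 1) =
      (\<Sum>x\<in>tuples k V. 2 - (if distinct x \<and> set x \<subseteq> W then 1/2 else 0 :: real))"
    by (intro sum.cong refl) (auto simp: violated_def UNIV_bool)
  also have "\<dots> = 2 * real (card (tuples k V)) - real (card ?D) / 2"
    using assms by (simp add: sum_subtractf sum.If_cases D)
  also have "\<dots> = 2 * real (card V) ^ k - real (card ?D) / 2"
    using assms by (simp add: card_tuples)
  also have "\<dots> \<le> 2 * real (card V) ^ k * (1 - 1 / (4 * 8 ^ k))"
  proof -
    have "real (card V ^ k) \<le> real (8 ^ k * card ?D)"
      using card_distinct_tuples_ge[OF fin assms(3,4)] by (rule of_nat_mono)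
    then show ?thesis
      by (simp add: field_simps)
  qed
  finally show ?thesis .
qed

text \<open>Union bound over the pairs of \<open>W\<close> and \<open>a\<close>. Per variable, the
  pairs cost a factor 4, the \<open>m\<close> tolerated violations a factor 2, and the equations
  gain \<open>p ^ C\<close>; the bound \<open>1 / 32\<close> leaves \<open>1 / 4\<close>.\<close>

lemma sum_card_nearly_satisfiable_le:
  assumes V: "finite V" "card V = m" "m \<ge> 1" "8 * k \<le> m"
    and C: "(1 - 1 / (4 * 8 ^ k) :: real) ^ C \<le> 1 / 32"
  shows "(\<Sum>e\<in>{..<C * m} \<rightarrow>\<^sub>E tuples k V. real (card (nearly_satisfiable (C * m) m V e)))
    \<le> real m ^ (k * (C * m)) * 2 ^ (C * m) / 4"
proof -
  let ?N = "C * m"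
  define p :: real where "p = 1 - 1 / (4 * 8 ^ k)"
  let ?E = "{..<?N} \<rightarrow>\<^sub>E tuples k V"
  let ?WA = "{(W, a). a \<subseteq> W \<and> W \<subseteq> V \<and> card V \<le> 4 * card W}"
  let ?B = "\<lambda>W a e. {r \<in> {..<?N} \<rightarrow>\<^sub>E UNIV. card {j \<in> {..<?N}. violated W a (e j) (r j)} \<le> m}"
  have sub: "?WA \<subseteq> Pow V \<times> Pow V"
    by auto
  have fin: "finite ?WA"
    using V by (intro finite_subset[OF sub]) auto
  have "card ?WA \<le> card (Pow V \<times> Pow V)"
    using V by (intro card_mono[OF _ sub]) auto
  also have "\<dots> = 4 ^ m"
    using V by (simp add: card_cartesian_product card_Pow flip: power_mult_distrib)
  finally have "real (card ?WA) \<le> real (4 ^ m)"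
    by (rule of_nat_mono)
  then have card_WA: "real (card ?WA) \<le> 4 ^ m"
    by simp
  have p: "0 \<le> p"
  proof -
    have "(1 :: real) \<le> 4 * 8 ^ k"
      using one_le_power[of "8 :: real" k] by linarith
    then show ?thesis
      by (simp add: p_def)
  qed
  have "real (card (nearly_satisfiable ?N m V e)) \<le> (\<Sum>(W, a)\<in>?WA. real (card (?B W a e)))" for e
  proof -
    have "nearly_satisfiable ?N m V e = (\<Union>(W, a)\<in>?WA. ?B W a e)"
      by (auto simp: nearly_satisfiable_def)
    then have "card (nearly_satisfiable ?N m V e) \<le> (\<Sum>(W, a)\<in>?WA. card (?B W a e))"
      using card_UN_le[OF fin] by (simp add: case_prod_unfold)
    then have "real (card (nearly_satisfiable ?N m V e)) \<le> real (\<Sum>(W, a)\<in>?WA. card (?B W a e))"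
      by (rule of_nat_mono)
    then show ?thesis
      by (simp add: case_prod_unfold)
  qed
  then have "(\<Sum>e\<in>?E. real (card (nearly_satisfiable ?N m V e))) \<le>
      (\<Sum>e\<in>?E. \<Sum>(W, a)\<in>?WA. real (card (?B W a e)))"
    by (rule sum_mono)
  also have "\<dots> = (\<Sum>(W, a)\<in>?WA. \<Sum>e\<in>?E. real (card (?B W a e)))"
    by (subst sum.swap) (simp add: case_prod_unfold)
  also have "\<dots> \<le> (\<Sum>(W, a)\<in>?WA. 2 ^ m * (2 * real m ^ k * p) ^ ?N)"
  proof (rule sum_mono, clarify)
    fix W a assume Wa: "a \<subseteq> W" "W \<subseteq> V" "card V \<le> 4 * card W"
    have "(\<Sum>e\<in>?E. real (card (?B W a e))) \<le>
        2 ^ m * (\<Sum>x\<in>tuples k V. \<Sum>b\<in>UNIV. if violated W a x b then 1/2 else 1) ^ ?N"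
      using V by (intro sum_card_few_hits_le) auto
    also have "\<dots> \<le> 2 ^ m * (2 * real m ^ k * p) ^ ?N"
      using sum_violated_weights_le[of V W k a, folded p_def] V Wa
      by (intro mult_left_mono power_mono sum_nonneg) auto
    finally show "(\<Sum>e\<in>?E. real (card (?B W a e))) \<le> 2 ^ m * (2 * real m ^ k * p) ^ ?N" .
  qed
  also have "\<dots> = real (card ?WA) * (2 ^ m * (2 * real m ^ k * p) ^ ?N)"
    by (simp add: case_prod_unfold)
  also have "\<dots> \<le> 4 ^ m * (2 ^ m * (2 * real m ^ k * p) ^ ?N)"
    using p by (intro mult_right_mono card_WA) auto
  also have "\<dots> = (4 * 2 * p ^ C) ^ m * (real m ^ (k * ?N) * 2 ^ ?N)"
  proof -
    have "(2 * real m ^ k * p) ^ ?N = 2 ^ ?N * real m ^ (k * ?N) * (p ^ C) ^ m"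
      by (simp only: power_mult_distrib flip: power_mult)
    then show ?thesis
      by (simp only: power_mult_distrib mult_ac)
  qed
  also have "\<dots> \<le> (1 / 4) ^ m * (real m ^ (k * ?N) * 2 ^ ?N)"
    using C p by (intro mult_right_mono power_mono) (auto simp: p_def[symmetric])
  also have "\<dots> \<le> (1 / 4) ^ 1 * (real m ^ (k * ?N) * 2 ^ ?N)"
    using V by (intro mult_right_mono power_decreasing) auto
  finally show ?thesis
    by simp
qed

text \<open>At least \<open>6/7\<close> of the systems expand. If each of them had half of the
  right-hand sides nearly satisfiable, the average over all systems would be at least
  \<open>3/7\<close>, but it is at most \<open>1/4\<close>.\<close>

lemma exists_expanding_unsatisfiable:
  fixes k C S m :: nat
  assumes k: "k \<ge> 3" and C: "C \<ge> 1" and small: "S * (1944 * C\<^sup>2 * k ^ 3) \<le> m"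
    and V: "finite V" "card V = m" "m \<ge> 1" "8 * k \<le> m"
    and decay: "(1 - 1 / (4 * 8 ^ k) :: real) ^ C \<le> 1 / 32"
  obtains e where "e \<in> {..<C * m} \<rightarrow>\<^sub>E tuples k V"
    and "\<And>s. s \<in> {1..S} \<Longrightarrow> e \<notin> nonexpanding k (C * m) s V"
    and "2 * card (nearly_satisfiable (C * m) m V e) < 2 ^ (C * m)"
proof -
  let ?N = "C * m"
  let ?E = "{..<?N} \<rightarrow>\<^sub>E tuples k V"
  let ?bad = "\<Union>s\<in>{1..S}. nonexpanding k ?N s V"
  let ?w = "\<lambda>e. real (card (nearly_satisfiable ?N m V e))"
  have "\<exists>e\<in>?E - ?bad. 2 * card (nearly_satisfiable ?N m V e) < 2 ^ ?N"
  proof (rule ccontr)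
    assume "\<not> ?thesis"
    then have "2 ^ ?N \<le> 2 * card (nearly_satisfiable ?N m V e)" if "e \<in> ?E - ?bad" for e
      using that not_less by blast
    then have le: "real (2 ^ ?N) \<le> real (2 * card (nearly_satisfiable ?N m V e))" if "e \<in> ?E - ?bad" for e
      using that by (intro of_nat_mono) blast
    then have ge: "2 ^ ?N / 2 \<le> ?w e" if "e \<in> ?E - ?bad" for e
      using le[OF that] by simp
    have fin: "finite ?E"
      using V by (intro finite_PiE) auto
    have card_E: "card ?E = m ^ (k * ?N)"
      using V by (simp add: card_PiE card_tuples power_mult)
    have bad: "?bad \<subseteq> ?E"
      by (auto simp: nonexpanding_def)
    have "real (card ?bad) \<le> real m ^ (k * ?N) / 7"
      using card_nonexpanding_Union[OF k C small V(1,2)] .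
    moreover have "real (card (?E - ?bad)) = real m ^ (k * ?N) - real (card ?bad)"
      using bad fin card_mono[OF fin bad] by (simp add: card_Diff_subset finite_subset card_E of_nat_diff)
    ultimately have "real m ^ (k * ?N) * (6 / 7) * (2 ^ ?N / 2) \<le> real (card (?E - ?bad)) * (2 ^ ?N / 2)"
      by (intro mult_right_mono) auto
    also have "\<dots> = (\<Sum>e\<in>?E - ?bad. 2 ^ ?N / 2)"
      by simp
    also have "\<dots> \<le> (\<Sum>e\<in>?E - ?bad. ?w e)"
      by (intro sum_mono ge)
    also have "\<dots> \<le> (\<Sum>e\<in>?E. ?w e)"
      using fin by (intro sum_mono2) auto
    also have "\<dots> \<le> real m ^ (k * ?N) * 2 ^ ?N / 4"
      by (intro sum_card_nearly_satisfiable_le V decay)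
    also have "\<dots> = real m ^ (k * ?N) * 2 ^ ?N * (1 / 4)"
      by simp
    also have "real m ^ (k * ?N) * (6 / 7) * (2 ^ ?N / 2) = real m ^ (k * ?N) * 2 ^ ?N * (3 / 7)"
      by simp
    finally have "real m ^ (k * ?N) * 2 ^ ?N * (3 / 7) \<le> real m ^ (k * ?N) * 2 ^ ?N * (1 / 4)" .
    moreover have "real m ^ (k * ?N) * 2 ^ ?N > 0"
      using V(3) by (intro mult_pos_pos zero_less_power) auto
    ultimately have "3 / 7 \<le> (1 / 4 :: real)"
      by (simp only: mult_le_cancel_left_pos)
    then show False
      by simp
  qed
  with that show ?thesis
    by blast
qed

subsection \<open>The hypergraph of a system of equations\<close>

text \<open>The literal of \<open>v\<close> that is true under \<open>Y\<close>: even numbers are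
  positive literals, odd ones negative. The two literals of 0 coincide by truncated subtraction, so
  variables start at 1.\<close>

definition literal :: "nat set \<Rightarrow> nat \<Rightarrow> nat" where
  "literal Y v = (if v \<in> Y then 2 * v else 2 * v - 1)"

definition var_of :: "nat \<Rightarrow> nat" where
  "var_of l = (l + 1) div 2"

lemma var_of_literal [simp]: "v \<ge> 1 \<Longrightarrow> var_of (literal Y v) = v"
  by (simp add: literal_def var_of_def)

lemma eq_literal_iff: "v \<ge> 1 \<Longrightarrow> l = literal Y v \<longleftrightarrow> var_of l = v \<and> (even l \<longleftrightarrow> v \<in> Y)"
  by (auto simp: literal_def var_of_def)

lemma literal_le: "literal Y v \<le> 2 * v"
  by (simp add: literal_def)

lemma literal_ge: "v \<ge> 1 \<Longrightarrow> literal Y v \<ge> 1"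
  by (cases "v \<in> Y"; simp add: literal_def; linarith)

lemma inj_on_literal: "inj_on (literal Y) {1..}"
  by (rule inj_on_inverseI[of _ var_of]) simp

lemma independence_number_ge_card:
  assumes "independent_set n E S"
  shows "card S \<le> independence_number n E"
proof -
  have "finite {card S | S. independent_set n E S}"
    by (rule finite_subset[of _ "card ` Pow {1..n}"]) (auto simp: independent_set_def)
  then show ?thesis
    unfolding independence_number_def using assms by (intro Max_ge) auto
qed

text \<open>\<open>k > 0\<close> rules out an empty hyperedge, so the empty set is independent and
  \<open>Max\<close> ranges over a nonempty set.\<close>

lemma independence_number_attained:
  assumes "uniform_hypergraph k n E" "k > 0"
  obtains S where "independent_set n E S" "card S = independence_number n E"
proof -
  have "{} \<notin> E"
    using assms by (auto simp: uniform_hypergraph_def)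
  then have "independent_set n E {}"
    by (auto simp: independent_set_def)
  moreover have "finite {card S | S. independent_set n E S}"
    by (rule finite_subset[of _ "card ` Pow {1..n}"]) (auto simp: independent_set_def)
  ultimately have "independence_number n E \<in> {card S | S. independent_set n E S}"
    unfolding independence_number_def by (intro Max_in) auto
  with that show ?thesis
    by auto
qed

locale xor_hypergraph =
  fixes k m D q :: nat and J :: "nat set" and e :: "nat \<Rightarrow> nat set"
  assumes k: "k \<ge> 3" and D: "D \<ge> 1" and q: "q \<ge> 2" and finite_J: "finite J"
    and e_subset: "\<And>j. j \<in> J \<Longrightarrow> e j \<subseteq> {1..m}"
    and card_e: "\<And>j. j \<in> J \<Longrightarrow> card (e j) = k"
    and degree_le: "\<And>v. card {j \<in> J. v \<in> e j} \<le> D"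
    and expanding: "\<And>F. F \<subseteq> J \<Longrightarrow> F \<noteq> {} \<Longrightarrow> card F \<le> q \<Longrightarrow> k * card F < 2 * card (\<Union>j\<in>F. e j)"
begin

definition hyperedge :: "nat \<Rightarrow> nat set \<Rightarrow> nat set" where
  "hyperedge j Y = literal Y ` e j"

definition hyperedges :: "(nat \<Rightarrow> bool) \<Rightarrow> nat set set" where
  "hyperedges r = {hyperedge j Y | j Y. j \<in> J \<and> Y \<subseteq> e j \<and> odd (card Y) \<noteq> r j}"

lemma finite_e: "j \<in> J \<Longrightarrow> finite (e j)"
  using e_subset finite_subset by blast

lemma e_ge_1: "j \<in> J \<Longrightarrow> v \<in> e j \<Longrightarrow> v \<ge> 1"
  using e_subset by fastforce

lemma mem_hyperedge_iff:
  assumes "j \<in> J"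
  shows "l \<in> hyperedge j Y \<longleftrightarrow> var_of l \<in> e j \<and> (even l \<longleftrightarrow> var_of l \<in> Y)"
  using e_ge_1[OF assms] by (auto simp: hyperedge_def image_iff eq_literal_iff)

lemma var_of_hyperedge: "j \<in> J \<Longrightarrow> var_of ` hyperedge j Y = e j"
  using e_ge_1 by (force simp: hyperedge_def image_image)

text \<open>Two equations on the same variables would contradict expansion for pairs; this is why
  \<open>q \<ge> 2\<close> is required.\<close>

lemma inj_e:
  assumes "i \<in> J" "j \<in> J" "e i = e j"
  shows "i = j"
proof (rule ccontr)
  assume "i \<noteq> j"
  then have "k * card {i, j} < 2 * card (\<Union>x\<in>{i, j}. e x)"
    using assms q by (intro expanding) auto
  with \<open>i \<noteq> j\<close> assms card_e show False
    by simp
qed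

text \<open>The variables below the literals determine the equation, and the even literals determine
  the signs.\<close>

lemma hyperedge_inject:
  assumes "i \<in> J" "j \<in> J" "Y \<subseteq> e i" "Z \<subseteq> e j" and eq: "hyperedge i Y = hyperedge j Z"
  shows "i = j \<and> Y = Z"
proof
  show "i = j"
    using var_of_hyperedge[of i Y] var_of_hyperedge[of j Z] assms by (intro inj_e) auto
  have Y: "Y = {v. 2 * v \<in> hyperedge i Y}"
    using assms(3) by (auto simp: mem_hyperedge_iff[OF assms(1)] var_of_def)
  have Z: "Z = {v. 2 * v \<in> hyperedge j Z}"
    using assms(4) by (auto simp: mem_hyperedge_iff[OF assms(2)] var_of_def)
  show "Y = Z"
    by (subst Y, subst Z) (simp add: eq)
qed

lemma card_hyperedge: "j \<in> J \<Longrightarrow> card (hyperedge j Y) = k"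
  unfolding hyperedge_def using card_e e_ge_1
  by (subst card_image) (auto intro!: inj_on_subset[OF inj_on_literal])

lemma hyperedge_subset:
  assumes "j \<in> J"
  shows "hyperedge j Y \<subseteq> {1..2 * m}"
proof
  fix l assume "l \<in> hyperedge j Y"
  then obtain v where v: "v \<in> e j" "l = literal Y v"
    by (auto simp: hyperedge_def)
  then have "1 \<le> v" "v \<le> m"
    using e_subset[OF assms] by auto
  with v literal_le[of Y v] literal_ge[of v Y] show "l \<in> {1..2 * m}"
    by simp
qed

lemma finite_hyperedges: "finite (hyperedges r)"
proof (rule finite_subset)
  show "hyperedges r \<subseteq> Pow {1..2 * m}"
    using hyperedge_subset by (force simp: hyperedges_def)
qed simp

text \<open>
  Membership of \<open>partner j v\<close> in \<open>Y\<close> is used to correct the parity of \<open>Y\<close>; this enumerates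
  the hyperedges at a vertex in such a way that each position depends on a single bit of \<open>r\<close>.
\<close>

definition partner :: "nat \<Rightarrow> nat \<Rightarrow> nat" where
  "partner j v = (SOME w. w \<in> e j - {v})"

text \<open>A slot fixes an equation and the signs of its variables other than that of
  \<open>l\<close> and the partner. No right-hand side enters, so neither the length of a list nor
  the position of its padding reveals anything.\<close>

definition slot_set :: "nat \<Rightarrow> (nat \<times> nat set) set" where
  "slot_set l = (SIGMA j:{j \<in> J. var_of l \<in> e j}. Pow (e j - {var_of l, partner j (var_of l)}))"

definition completion :: "nat \<Rightarrow> nat \<Rightarrow> nat set \<Rightarrow> bool \<Rightarrow> nat set" where
  "completion l j Z b =
     (let Y = (if even l then insert (var_of l) Z else Z)
      in if odd (card Y) \<noteq> b then Y else insert (partner j (var_of l)) Y)"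

definition slot_edge :: "nat \<Rightarrow> (nat \<Rightarrow> bool) \<Rightarrow> nat \<times> nat set \<Rightarrow> nat set" where
  "slot_edge l r s = hyperedge (fst s) (completion l (fst s) (snd s) (r (fst s)))"

lemma partner:
  assumes "j \<in> J"
  shows "partner j v \<in> e j" "partner j v \<noteq> v"
proof -
  have "\<not> e j \<subseteq> {v}"
    using card_mono[of "{v}" "e j"] card_e[OF assms] k by auto
  then have "\<exists>w. w \<in> e j - {v}"
    by blast
  then have "partner j v \<in> e j - {v}"
    unfolding partner_def by (rule someI_ex)
  then show "partner j v \<in> e j" "partner j v \<noteq> v"
    by auto
qed

lemma completion:
  fixes b :: bool
  assumes "(j, Z) \<in> slot_set l"
  defines "Y \<equiv> completion l j Z b"
  shows "Y \<subseteq> e j" "odd (card Y) \<noteq> b" "var_of l \<in> Y \<longleftrightarrow> even l"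
    and "Y - {var_of l, partner j (var_of l)} = Z"
proof -
  define v w where "v = var_of l" and "w = partner j v"
  define Y0 where "Y0 = (if even l then insert v Z else Z)"
  have j: "j \<in> J" "v \<in> e j" and Z: "Z \<subseteq> e j" "v \<notin> Z" "w \<notin> Z"
    using assms by (auto simp: slot_set_def v_def w_def)
  have w: "w \<in> e j" "w \<noteq> v"
    using partner[OF j(1)] by (auto simp: w_def)
  have Y: "Y = (if odd (card Y0) \<noteq> b then Y0 else insert w Y0)"
    by (simp add: Y_def completion_def Y0_def v_def w_def Let_def)
  have Y0: "Y0 \<subseteq> e j" "w \<notin> Y0"
    using j Z w by (auto simp: Y0_def)
  moreover have "finite Y0"
    using Y0(1) finite_e[OF j(1)] finite_subset by blast
  ultimately show "odd (card Y) \<noteq> b"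
    by (auto simp: Y)
  show "Y \<subseteq> e j"
    using Y0 w by (auto simp: Y)
  show "var_of l \<in> Y \<longleftrightarrow> even l"
    using Z w unfolding v_def[symmetric] by (auto simp: Y Y0_def)
  show "Y - {var_of l, partner j (var_of l)} = Z"
    using Z w unfolding v_def[symmetric] w_def[symmetric] by (auto simp: Y Y0_def)
qed

lemma completion_surj:
  assumes j: "j \<in> J" "var_of l \<in> e j" and Y: "Y \<subseteq> e j" "odd (card Y) \<noteq> b" "var_of l \<in> Y \<longleftrightarrow> even l"
  defines "Z \<equiv> Y - {var_of l, partner j (var_of l)}"
  shows "(j, Z) \<in> slot_set l" "completion l j Z b = Y"
proof -
  show "(j, Z) \<in> slot_set l"
    using assms by (auto simp: slot_set_def)
  define v w where "v = var_of l" and "w = partner j v"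
  have w: "w \<noteq> v"
    using partner[OF j(1)] by (auto simp: w_def)
  have fin: "finite Y"
    using Y(1) finite_e[OF j(1)] finite_subset by blast
  have Y0: "(if even l then insert v Z else Z) = Y - {w}"
    using Y(3) w by (auto simp: Z_def v_def[symmetric] w_def[symmetric])
  have eq: "completion l j Z b = (if odd (card (Y - {w})) \<noteq> b then Y - {w} else insert w (Y - {w}))"
    by (simp only: completion_def Let_def v_def[symmetric] w_def[symmetric] Y0)
  show "completion l j Z b = Y"
  proof (cases "w \<in> Y")
    case True
    then have "card Y = Suc (card (Y - {w}))"
      using fin by (metis card_Suc_Diff1)
    then have "odd (card (Y - {w})) = b"
      using Y(2) by auto
    then show ?thesis
      using True unfolding eq by auto
  next
    case False
    then show ?thesis
      using Y(2) unfolding eq by auto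
  qed
qed

lemma slot_edge_bij:
  "bij_betw (slot_edge l r) (slot_set l) {h \<in> hyperedges r. l \<in> h}"
  unfolding bij_betw_def
proof
  show "inj_on (slot_edge l r) (slot_set l)"
  proof (rule inj_onI, clarify)
    fix i Z j Z'
    assume i: "(i, Z) \<in> slot_set l" and j: "(j, Z') \<in> slot_set l"
      and eq: "slot_edge l r (i, Z) = slot_edge l r (j, Z')"
    have J: "i \<in> J" "j \<in> J"
      using i j by (auto simp: slot_set_def)
    have "i = j \<and> completion l i Z (r i) = completion l j Z' (r j)"
      using eq completion(1)[OF i] completion(1)[OF j] by (intro hyperedge_inject J) (auto simp: slot_edge_def)
    then show "i = j \<and> Z = Z'"
      using completion(4)[OF i, of "r i"] completion(4)[OF j, of "r j"] by auto
  qed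
  show "slot_edge l r ` slot_set l = {h \<in> hyperedges r. l \<in> h}"
  proof (intro equalityI subsetI)
    fix h assume "h \<in> slot_edge l r ` slot_set l"
    then obtain j Z where s: "(j, Z) \<in> slot_set l" and h: "h = hyperedge j (completion l j Z (r j))"
      by (auto simp: slot_edge_def)
    have "j \<in> J" "var_of l \<in> e j"
      using s by (auto simp: slot_set_def)
    then show "h \<in> {h \<in> hyperedges r. l \<in> h}"
      using completion(1-3)[OF s, of "r j"] unfolding h by (auto simp: hyperedges_def mem_hyperedge_iff)
  next
    fix h assume "h \<in> {h \<in> hyperedges r. l \<in> h}"
    then obtain j Y where h: "h = hyperedge j Y" and Y: "j \<in> J" "Y \<subseteq> e j" "odd (card Y) \<noteq> r j"
      and "l \<in> h"
      by (auto simp: hyperedges_def)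
    then have "var_of l \<in> e j" "var_of l \<in> Y \<longleftrightarrow> even l"
      by (auto simp: mem_hyperedge_iff)
    from completion_surj[OF Y(1) this(1) Y(2,3) this(2)]
    obtain Z where "(j, Z) \<in> slot_set l" "completion l j Z (r j) = Y"
      by blast
    then show "h \<in> slot_edge l r ` slot_set l"
      by (intro image_eqI[of _ _ "(j, Z)"]) (simp_all add: slot_edge_def h)
  qed
qed

lemma finite_slot_set: "finite (slot_set l)"
  unfolding slot_set_def using finite_J finite_e by (intro finite_SigmaI) auto

lemma card_slot_set_le: "card (slot_set l) \<le> D * 2 ^ k"
proof -
  have "card (slot_set l) = (\<Sum>j\<in>{j \<in> J. var_of l \<in> e j}. card (Pow (e j - {var_of l, partner j (var_of l)})))"
    unfolding slot_set_def using finite_J finite_e by (intro card_SigmaI) auto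
  also have "\<dots> \<le> (\<Sum>j\<in>{j \<in> J. var_of l \<in> e j}. 2 ^ k)"
  proof (rule sum_mono)
    fix j assume j: "j \<in> {j \<in> J. var_of l \<in> e j}"
    have "card (Pow (e j - {var_of l, partner j (var_of l)})) \<le> card (Pow (e j))"
      using j finite_e by (intro card_mono) auto
    then show "card (Pow (e j - {var_of l, partner j (var_of l)})) \<le> 2 ^ k"
      using j card_e finite_e by (simp add: card_Pow)
  qed
  also have "\<dots> \<le> D * 2 ^ k"
    using degree_le by simp
  finally show ?thesis .
qed

text \<open>A single enumeration is chosen for all \<open>r\<close>, so a list position always
  refers to the same slot.\<close>

definition slots :: "nat \<Rightarrow> (nat \<times> nat set) list" where
  "slots l = (SOME ps. distinct ps \<and> set ps = slot_set l)"

lemma slots: "distinct (slots l)" "set (slots l) = slot_set l"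
proof -
  have "\<exists>ps. distinct ps \<and> set ps = slot_set l"
    using finite_distinct_list[OF finite_slot_set] by blast
  then have "distinct (slots l) \<and> set (slots l) = slot_set l"
    unfolding slots_def by (rule someI_ex)
  then show "distinct (slots l)" "set (slots l) = slot_set l"
    by auto
qed

definition degree_bound :: nat where
  "degree_bound = D * 2 ^ k"

definition incidences :: "(nat \<Rightarrow> bool) \<Rightarrow> incidence_lists" where
  "incidences r l = map (\<lambda>s. Some (slot_edge l r s)) (slots l) @ replicate (degree_bound - length (slots l)) None"

lemma represents_incidences: "represents n degree_bound (incidences r) (hyperedges r)"
  unfolding represents_def
proof (intro ballI exI conjI)
  fix l
  show "distinct (map (slot_edge l r) (slots l))"
    using slots slot_edge_bij[of l r] by (auto simp: distinct_map bij_betw_def)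
  show "set (map (slot_edge l r) (slots l)) = {h \<in> hyperedges r. l \<in> h}"
    using slots slot_edge_bij[of l r] by (auto simp: bij_betw_def)
  show "length (map (slot_edge l r) (slots l)) \<le> degree_bound"
    using slots(2)[of l] distinct_card[OF slots(1)[of l]] card_slot_set_le[of l] by (simp add: degree_bound_def)
  show "incidences r l = map Some (map (slot_edge l r) (slots l)) @
      replicate (degree_bound - length (map (slot_edge l r) (slots l))) None"
    by (simp add: incidences_def)
qed

lemma input_incidences:
  assumes "2 * m \<le> n"
  shows "bounded_degree_input k degree_bound n (hyperedges r) (incidences r)"
  unfolding bounded_degree_input_def
proof (intro conjI represents_incidences)
  show "uniform_hypergraph k n (hyperedges r)"
    unfolding uniform_hypergraph_def
  proof
    fix h assume "h \<in> hyperedges r"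
    then obtain j Y where "h = hyperedge j Y" "j \<in> J"
      by (auto simp: hyperedges_def)
    then show "h \<subseteq> {1..n} \<and> card h = k"
      using hyperedge_subset[of j Y] card_hyperedge[of j Y] assms by auto
  qed
  show "max_degree_le n degree_bound (hyperedges r)"
    unfolding max_degree_le_def vertex_degree_def
  proof
    fix l
    show "card {h \<in> hyperedges r. l \<in> h} \<le> degree_bound"
      using bij_betw_same_card[OF slot_edge_bij] card_slot_set_le by (metis degree_bound_def)
  qed
qed

text \<open>Supplies the locality hypothesis of \<open>run_frac_eq\<close>: a position holds padding
  for every \<open>r\<close>, or a slot of one equation \<open>j\<close>, completed according to
  \<open>r j\<close>.\<close>

lemma answer_local:
  "(\<exists>a. \<forall>r. answer n degree_bound (incidences r) l p = a) \<or>
   (\<exists>c\<in>J. \<exists>g. \<forall>r. answer n degree_bound (incidences r) l p = g (r c))"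
proof (cases "l \<in> {1..n} \<and> p < degree_bound \<and> p < length (slots l)")
  case True
  obtain j Z where jZ: "slots l ! p = (j, Z)"
    by (rule prod.exhaust)
  with True have "(j, Z) \<in> slot_set l"
    using nth_mem[of p "slots l"] slots(2)[of l] by simp
  then have "j \<in> J"
    by (auto simp: slot_set_def)
  moreover have "incidences r l ! p = Some (slot_edge l r (j, Z))" for r
    using True jZ by (simp add: incidences_def nth_append)
  then have "\<forall>r. answer n degree_bound (incidences r) l p = (\<lambda>b. Some (hyperedge j (completion l j Z b))) (r j)"
    using True by (simp add: answer_def slot_edge_def)
  ultimately show ?thesis
    by (intro disjI2 bexI[of _ j] exI[of _ "\<lambda>b. Some (hyperedge j (completion l j Z b))"])
next
  case False
  then have "\<forall>r. answer n degree_bound (incidences r) l p = None"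
    by (auto simp: answer_def incidences_def nth_append)
  then show ?thesis
    by (intro disjI1 exI[of _ None])
qed

section \<open>Solvable systems and systems far from large independence number\<close>

lemma satisfiable_independence_number:
  assumes n: "2 * m \<le> n" and r: "\<And>j. j \<in> J \<Longrightarrow> r j = odd (card (X \<inter> e j))"
  shows "independence_number_ge 2 n (hyperedges r)"
proof -
  \<comment> \<open>For odd \<open>n\<close> the last vertex lies in no hyperedge; adding it raises
    the size from \<open>m\<close> to \<open>m + 1\<close>, which \<open>n / 2\<close>
    requires.\<close>
  let ?S = "literal X ` {1..m} \<union> {2 * m + 1..n}"
  have le: "literal X v \<le> 2 * m" if "v \<in> {1..m}" for v
    using literal_le[of X v] that by auto
  have "independent_set n (hyperedges r) ?S"
    unfolding independent_set_def
  proof (intro conjI notI)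
    show "?S \<subseteq> {1..n}"
      using le literal_ge n by fastforce
    assume "\<exists>h\<in>hyperedges r. h \<subseteq> ?S"
    then obtain j Y where j: "j \<in> J" and Y: "Y \<subseteq> e j" "odd (card Y) \<noteq> r j" and sub: "hyperedge j Y \<subseteq> ?S"
      by (auto simp: hyperedges_def)
    have "v \<in> Y \<longleftrightarrow> v \<in> X" if v: "v \<in> e j" for v
    proof -
      have v1: "v \<ge> 1" "v \<le> m"
        using e_subset[OF j] v by auto
      have "literal Y v \<in> ?S"
        using v sub by (auto simp: hyperedge_def)
      moreover have "literal Y v \<le> 2 * m"
        using literal_le[of Y v] v1 by simp
      ultimately obtain v' where v': "v' \<ge> 1" "literal Y v = literal X v'"
        by auto
      then have "v' = v"
        using v1 var_of_literal by metis
      with v' v1 eq_literal_iff[of v "literal Y v" X] eq_literal_iff[of v "literal Y v" Y] show ?thesis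
        by simp
    qed
    with Y(1) have "Y = X \<inter> e j"
      by auto
    with Y(2) r[OF j] show False
      by simp
  qed
  from independence_number_ge_card[OF this]
  have "card ?S \<le> independence_number n (hyperedges r)" .
  moreover have "card ?S = m + (n - 2 * m)"
  proof -
    have "card (literal X ` {1..m}) = m"
      by (subst card_image) (auto intro: inj_on_subset[OF inj_on_literal])
    moreover have "literal X ` {1..m} \<inter> {2 * m + 1..n} = {}"
      using le by fastforce
    ultimately show ?thesis
      by (simp add: card_Un_disjoint)
  qed
  ultimately have "n \<le> 2 * independence_number n (hyperedges r)"
    using n by linarith
  then have "real n \<le> real (2 * independence_number n (hyperedges r))"
    by (rule of_nat_mono)
  then show ?thesis
    by (simp add: independence_number_ge_def)
qed

text \<open>A violated equation inside \<open>W\<close> yields the hyperedge whose signs are given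
  by \<open>a\<close>; different equations yield different hyperedges.\<close>

lemma card_hyperedges_inside_ge:
  assumes "\<And>v. v \<in> W \<Longrightarrow> literal a v \<in> S"
  shows "card {j \<in> J. e j \<subseteq> W \<and> r j \<noteq> odd (card (a \<inter> e j))} \<le> card {h \<in> hyperedges r. h \<subseteq> S}"
proof (rule card_inj_on_le)
  let ?f = "\<lambda>j. hyperedge j (a \<inter> e j)"
  let ?V = "{j \<in> J. e j \<subseteq> W \<and> r j \<noteq> odd (card (a \<inter> e j))}"
  show "inj_on ?f ?V"
  proof (rule inj_onI)
    fix i j assume "i \<in> ?V" "j \<in> ?V" "?f i = ?f j"
    then show "i = j"
      using hyperedge_inject[of i j "a \<inter> e i" "a \<inter> e j"] by simp
  qed
  show "finite {h \<in> hyperedges r. h \<subseteq> S}"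
    using finite_hyperedges by simp
  show "?f ` ?V \<subseteq> {h \<in> hyperedges r. h \<subseteq> S}"
  proof clarify
    fix j assume j: "j \<in> J" "e j \<subseteq> W" "r j \<noteq> odd (card (a \<inter> e j))"
    have "literal (a \<inter> e j) v = literal a v" if "v \<in> e j" for v
      using that by (simp add: literal_def)
    then have "?f j \<subseteq> S"
      using assms j by (auto simp: hyperedge_def)
    moreover have "?f j \<in> hyperedges r"
      unfolding hyperedges_def using j by blast
    ultimately show "?f j \<in> hyperedges r \<and> ?f j \<subseteq> S"
      by simp
  qed
qed

lemma far_from_independence:
  assumes n: "n div 2 = m" "n \<ge> 2"
    and unsat: "\<And>W a. a \<subseteq> W \<Longrightarrow> W \<subseteq> {1..m} \<Longrightarrow> m \<le> 2 * card W \<Longrightarrow>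
      m < card {j \<in> J. e j \<subseteq> W \<and> r j \<noteq> odd (card (a \<inter> e j))}"
  shows "far_from k degree_bound (1 / (2 * real degree_bound)) (independence_number_ge 2) n (hyperedges r)"
  unfolding far_from_def
proof (intro allI impI, elim conjE)
  fix E' assume E': "uniform_hypergraph k n E'" "independence_number_ge 2 n E'"
  obtain S where S: "independent_set n E' S" "card S = independence_number n E'"
    using independence_number_attained[OF E'(1)] k by auto
  have "real n / 2 \<le> real (card S)"
    using E'(2) S(2) by (simp add: independence_number_ge_def)
  then have card_S: "n \<le> 2 * card S"
    by linarith
  let ?T = "S \<inter> {1..2 * m}"
  define W where "W = var_of ` ?T"
  \<comment> \<open>A variable with both literals in \<open>S\<close> is made true; a variable of
    \<open>W\<close> outside \<open>a\<close> has its negative literal in \<open>S\<close>.\<close>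
  define a where "a = {v \<in> W. 2 * v \<in> S}"
  have S_sub: "S \<subseteq> {1..n}"
    using S by (simp add: independent_set_def)
  then have finS: "finite S"
    using finite_subset by blast
  have finW: "finite W"
    by (simp add: W_def)
  have "S \<subseteq> ?T \<union> {2 * m + 1..n}"
    using S_sub by auto
  then have "card S \<le> card (?T \<union> {2 * m + 1..n})"
    by (intro card_mono) auto
  also have "\<dots> \<le> card ?T + (n - 2 * m)"
    using card_Un_le[of ?T "{2 * m + 1..n}"] by simp
  finally have T: "m \<le> card ?T"
    using card_S n by linarith
  have "?T \<subseteq> (\<lambda>v. 2 * v) ` W \<union> (\<lambda>v. 2 * v - 1) ` W"
  proof
    fix l assume l: "l \<in> ?T"
    then have "var_of l \<in> W"
      by (simp add: W_def)
    moreover have "l = 2 * var_of l \<or> l = 2 * var_of l - 1"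
      unfolding var_of_def by presburger
    ultimately show "l \<in> (\<lambda>v. 2 * v) ` W \<union> (\<lambda>v. 2 * v - 1) ` W"
      by blast
  qed
  then have "card ?T \<le> card ((\<lambda>v. 2 * v) ` W \<union> (\<lambda>v. 2 * v - 1) ` W)"
    using finW by (intro card_mono) auto
  also have "\<dots> \<le> card ((\<lambda>v. 2 * v) ` W) + card ((\<lambda>v. 2 * v - 1) ` W)"
    by (rule card_Un_le)
  also have "\<dots> \<le> card W + card W"
    by (intro add_mono card_image_le finW)
  finally have W: "m \<le> 2 * card W"
    using T by simp
  have "W \<subseteq> {1..m}"
    by (auto simp: W_def var_of_def)
  then have many: "m < card {j \<in> J. e j \<subseteq> W \<and> r j \<noteq> odd (card (a \<inter> e j))}"
    using W by (intro unsat) (auto simp: a_def)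
  have "literal a v \<in> S" if v: "v \<in> W" for v
  proof -
    obtain l where l: "l \<in> S" "l \<ge> 1" "v = var_of l"
      using v by (auto simp: W_def)
    have "l = 2 * v \<or> l = 2 * v - 1"
      unfolding l(3) var_of_def by presburger
    with l v show ?thesis
      by (auto simp: literal_def a_def)
  qed
  with many have "m < card {h \<in> hyperedges r. h \<subseteq> S}"
    by (intro less_le_trans[OF _ card_hyperedges_inside_ge[of W a S r]])
  also have "\<dots> \<le> card (hyperedges r - E')"
    using S finite_hyperedges by (intro card_mono) (auto simp: independent_set_def)
  \<comment> \<open>At least \<open>m + 1\<close> hyperedges are missing from \<open>E'\<close>, and
    \<open>n \<le> 2 * m + 1\<close>; the strict inequality absorbs the rounding.\<close>
  finally have "n < 2 * card (hyperedges r - E')"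
    using n by linarith
  then have "real n < real (2 * card (hyperedges r - E'))"
    by (rule of_nat_less_iff[THEN iffD2])
  then have "real n < 2 * (real (card (hyperedges r - E')) + real (card (E' - hyperedges r)))"
    by simp
  moreover have "degree_bound > 0"
    using D by (simp add: degree_bound_def)
  ultimately show "1 / (2 * real degree_bound) < hypergraph_dist degree_bound n (hyperedges r) E'"
    using n by (simp add: hypergraph_dist_def field_simps)
qed

end

subsection \<open>The lower bound\<close>

text \<open>Exchanges the randomness of the tester with that of the input, so that a single tree can
  be treated at a time.\<close>

lemma expectation_frac:
  assumes "finite \<Omega>"
  shows "measure_pmf.expectation T (\<lambda>t. frac \<Omega> (\<lambda>w. Q w t)) =
    (\<Sum>w\<in>\<Omega>. measure_pmf.prob T {t. Q w t}) / card \<Omega>"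
proof -
  have "frac \<Omega> (\<lambda>w. Q w t) = (\<Sum>w\<in>\<Omega>. indicator {t. Q w t} t) / card \<Omega>" for t
    using assms by (simp add: frac_def indicator_def sum.If_cases Int_def)
  moreover have "measure_pmf.expectation T (\<lambda>t. \<Sum>w\<in>\<Omega>. indicator {t. Q w t} t :: real) =
      (\<Sum>w\<in>\<Omega>. measure_pmf.expectation T (indicator {t. Q w t}))"
    by (rule Bochner_Integration.integral_sum) (simp add: less_top[symmetric])
  ultimately show ?thesis
    by simp
qed

context xor_hypergraph
begin

definition unsatisfiable :: "(nat \<Rightarrow> bool) \<Rightarrow> bool" where
  "unsatisfiable r \<longleftrightarrow> (\<forall>W a. a \<subseteq> W \<longrightarrow> W \<subseteq> {1..m} \<longrightarrow> m \<le> 2 * card W \<longrightarrow>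
     m < card {j \<in> J. e j \<subseteq> W \<and> r j \<noteq> odd (card (a \<inter> e j))})"

lemma run_incidences_frac_eq:
  assumes J: "J \<subseteq> {..<N}" and t: "\<And>r. num_queries (answer n degree_bound (incidences r)) t \<le> q"
  shows "frac (Pow {1..m}) (\<lambda>X. run (answer n degree_bound (incidences (parity e X))) t) =
    frac ({..<N} \<rightarrow>\<^sub>E UNIV) (\<lambda>r. run (answer n degree_bound (incidences r)) t)"
proof -
  have "frac (Pow {1..m}) (\<lambda>X. agrees {} b (parity e X) \<and> run (answer n degree_bound (incidences (parity e X))) t) =
    frac ({..<N} \<rightarrow>\<^sub>E UNIV) (\<lambda>r. agrees {} b r \<and> run (answer n degree_bound (incidences r)) t)" for b
  proof (rule run_frac_eq[where J = J and q = q and orc = "\<lambda>r. answer n degree_bound (incidences r)"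
        and F = "{}" and \<rho>' = "\<lambda>r. r"])
    show "finite ({..<N} \<rightarrow>\<^sub>E (UNIV :: bool set))"
      by (intro finite_PiE) auto
    fix F b assume F: "F \<subseteq> J" "finite F" "card F \<le> q"
    have "frac (Pow {1..m}) (\<lambda>X. agrees F b (parity e X)) = 1 / 2 ^ card F"
      by (rule frac_agrees_parity[where J = J and k = k and q = q]) (use F e_subset card_e expanding in auto)
    then show "frac (Pow {1..m}) (\<lambda>X. agrees F b (parity e X)) = frac ({..<N} \<rightarrow>\<^sub>E UNIV) (\<lambda>r. agrees F b r)"
      using F J by (simp add: frac_agrees_uniform)
  qed (use t answer_local in auto)
  then show ?thesis
    by (simp add: agrees_def)
qed

text \<open>Averaged over parities of assignments, acceptance is at least \<open>2/3\<close>, and by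
  indistinguishability the same holds for uniform right-hand sides. There, however, less than half
  are not \<open>unsatisfiable\<close>, so the average is strictly below
  \<open>1/3 + 2/3 * 1/2 = 2/3\<close>.\<close>

lemma no_tester:
  assumes J: "J \<subseteq> {..<N}" and n: "n div 2 = m" "n \<ge> 2"
    and unsat: "2 * card {r \<in> {..<N} \<rightarrow>\<^sub>E UNIV. \<not> unsatisfiable r} < 2 ^ N"
    and tester: "tester k degree_bound (1 / (2 * real degree_bound)) (independence_number_ge 2) n T"
    and few: "\<And>t r. t \<in> set_pmf T \<Longrightarrow> num_queries (answer n degree_bound (incidences r)) t \<le> q"
  shows False
proof -
  let ?orc = "\<lambda>r. answer n degree_bound (incidences r)"
  let ?R = "{..<N} \<rightarrow>\<^sub>E (UNIV :: bool set)" and ?acc = "\<lambda>r. accept_prob n degree_bound T (incidences r)"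
  let ?B = "{r \<in> ?R. \<not> unsatisfiable r}"
  have finR: "finite ?R"
    by (intro finite_PiE) auto
  have cardR: "card ?R = 2 ^ N"
    by (simp add: card_PiE)
  have input: "bounded_degree_input k degree_bound n (hyperedges r) (incidences r)" for r
    using n by (intro input_incidences) auto
  have yes: "2 / 3 \<le> ?acc (parity e X)" for X
    using tester input[of "parity e X"] satisfiable_independence_number[of n "parity e X" X] n
    by (auto simp: tester_def parity_def)
  have no: "?acc r \<le> 1 / 3" if "unsatisfiable r" for r
    using tester input[of r] far_from_independence[of n r] n that
    by (auto simp: tester_def unsatisfiable_def)
  have "2 / 3 = (\<Sum>X\<in>Pow {1..m}. 2 / 3 :: real) / card (Pow {1..m})"
    by (simp add: card_Pow)
  also have "\<dots> \<le> (\<Sum>X\<in>Pow {1..m}. ?acc (parity e X)) / card (Pow {1..m})"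
    by (intro divide_right_mono sum_mono yes) simp
  also have "\<dots> = measure_pmf.expectation T (\<lambda>t. frac (Pow {1..m}) (\<lambda>X. run (?orc (parity e X)) t))"
    by (simp add: expectation_frac accept_prob_def)
  also have "\<dots> = measure_pmf.expectation T (\<lambda>t. frac ?R (\<lambda>r. run (?orc r) t))"
    by (intro integral_cong_AE AE_pmfI run_incidences_frac_eq J few) simp_all
  also have "\<dots> = (\<Sum>r\<in>?R. ?acc r) / 2 ^ N"
    using finR cardR by (simp add: expectation_frac accept_prob_def)
  finally have "2 / 3 * 2 ^ N \<le> (\<Sum>r\<in>?R. ?acc r)"
    by (simp add: field_simps)
  also have "\<dots> \<le> (\<Sum>r\<in>?R. 1 / 3 + (if r \<in> ?B then 2 / 3 else 0))"
  proof (rule sum_mono)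
    fix r assume "r \<in> ?R"
    moreover have "?acc r \<le> 1"
      by (simp add: accept_prob_def)
    ultimately show "?acc r \<le> 1 / 3 + (if r \<in> ?B then 2 / 3 else 0)"
      using no[of r] by simp
  qed
  also have "\<dots> = 2 ^ N / 3 + 2 / 3 * real (card ?B)"
  proof -
    have "?R \<inter> {r. \<not> unsatisfiable r} = ?B"
      by auto
    then show ?thesis
      using finR cardR by (simp add: sum.distrib sum.If_cases)
  qed
  finally have "2 ^ N \<le> 2 * real (card ?B)"
    by simp
  moreover have "real (2 * card ?B) < real (2 ^ N)"
    using unsat by (rule of_nat_less_iff[THEN iffD2])
  ultimately show False
    by simp
qed

end

section \<open>Bounding the degree and choosing the parameters\<close>

lemma card_high_degree_le:
  fixes m :: nat
  assumes "\<And>j. j < N \<Longrightarrow> \<tau> j \<in> tuples k {1..m}"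
  shows "card {v \<in> {1..m}. D < card {j \<in> {..<N}. v \<in> set (\<tau> j)}} * D \<le> k * N"
proof -
  let ?B = "{v \<in> {1..m}. D < card {j \<in> {..<N}. v \<in> set (\<tau> j)}}"
  have "card ?B * D = (\<Sum>v\<in>?B. D)"
    by simp
  also have "\<dots> \<le> (\<Sum>v\<in>?B. card {j \<in> {..<N}. v \<in> set (\<tau> j)})"
    by (intro sum_mono) auto
  also have "\<dots> \<le> (\<Sum>v\<in>{1..m}. card {j \<in> {..<N}. v \<in> set (\<tau> j)})"
    by (intro sum_mono2) auto
  also have "\<dots> = (\<Sum>j<N. card {v \<in> {1..m}. v \<in> set (\<tau> j)})"
    by (intro sum_multicount_gen) auto
  also have "\<dots> \<le> (\<Sum>j<N. k)"
  proof (rule sum_mono)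
    fix j assume "j \<in> {..<N}"
    then have "length (\<tau> j) = k"
      using assms[of j] by (simp add: tuples_def)
    moreover have "card {v \<in> {1..m}. v \<in> set (\<tau> j)} \<le> card (set (\<tau> j))"
      by (intro card_mono) auto
    ultimately show "card {v \<in> {1..m}. v \<in> set (\<tau> j)} \<le> k"
      using card_length[of "\<tau> j"] by linarith
  qed
  finally show ?thesis
    by (simp add: mult.commute)
qed

text \<open>
  At most \<open>m / 4\<close> variables occur more than \<open>4 * k * C\<close> times; the equations containing one of
  them are discarded, which bounds the degree, and every set of at least \<open>m / 2\<close> variables still
  contains at least \<open>m / 4\<close> of the other ones.
\<close>

lemma no_tester_with_few_queries:
  fixes k C q m n :: nat
  assumes k: "k \<ge> 3" and C: "C \<ge> 1" and q: "q \<ge> 2" and n: "n div 2 = m" "n \<ge> 2"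
    and small: "q * (1944 * C\<^sup>2 * k ^ 3) \<le> m" and m: "8 * k \<le> m"
    and decay: "(1 - 1 / (4 * 8 ^ k) :: real) ^ C \<le> 1 / 32"
  defines "d \<equiv> 4 * k * C * 2 ^ k"
  assumes tester: "tester k d (1 / (2 * real d)) (independence_number_ge 2) n T"
    and few: "\<And>t A E. t \<in> set_pmf T \<Longrightarrow> bounded_degree_input k d n E A \<Longrightarrow> num_queries (answer n d A) t \<le> q"
  shows False
proof -
  let ?N = "C * m" and ?D = "4 * k * C"
  have m1: "m \<ge> 1"
    using m k by linarith
  obtain \<tau> where \<tau>: "\<tau> \<in> {..<?N} \<rightarrow>\<^sub>E tuples k {1..m}"
    and expand: "\<And>s. s \<in> {1..q} \<Longrightarrow> \<tau> \<notin> nonexpanding k ?N s {1..m}"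
    and unsat: "2 * card (nearly_satisfiable ?N m {1..m} \<tau>) < 2 ^ ?N"
    by (rule exists_expanding_unsatisfiable[OF k C small _ _ m1 m decay, of "{1..m}"]) auto
  have \<tau>_mem: "\<tau> j \<in> tuples k {1..m}" if "j < ?N" for j
    using \<tau> that by auto
  define B where "B = {v \<in> {1..m}. ?D < card {j \<in> {..<?N}. v \<in> set (\<tau> j)}}"
  define J where "J = {j \<in> {..<?N}. distinct (\<tau> j) \<and> set (\<tau> j) \<inter> B = {}}"
  define e where "e j = set (\<tau> j)" for j
  have J: "J \<subseteq> {..<?N}"
    by (auto simp: J_def)
  interpret xor_hypergraph k m ?D q J e
  proof
    show "finite J"
      using J finite_subset by blast
    show "1 \<le> ?D"
      using k C by simp
    fix j assume "j \<in> J"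
    then show "e j \<subseteq> {1..m}" "card (e j) = k"
      using \<tau>_mem[of j] by (auto simp: J_def e_def tuples_def distinct_card)
  next
    fix v
    show "card {j \<in> J. v \<in> e j} \<le> ?D"
    proof (cases "v \<in> {1..m} - B")
      case True
      have "card {j \<in> J. v \<in> e j} \<le> card {j \<in> {..<?N}. v \<in> set (\<tau> j)}"
        using J by (intro card_mono) (auto simp: e_def)
      with True show ?thesis
        by (auto simp: B_def)
    next
      case False
      have "v \<notin> e j" if "j \<in> J" for j
        using False that \<tau>_mem[of j] by (auto simp: J_def e_def tuples_def simp del: atLeastAtMost_iff)
      then have empty: "{j \<in> J. v \<in> e j} = {}"
        by blast
      show ?thesis
        unfolding empty by simp
    qed
  next
    fix F assume F: "F \<subseteq> J" "F \<noteq> {}" "card F \<le> q"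
    have "finite F"
      using F(1) J finite_subset by (metis finite_lessThan)
    then have "card F \<in> {1..q}"
      using F by (simp add: Suc_le_eq card_gt_0_iff)
    \<comment> \<open>Expansion passes to the remaining equations because it is a condition on each
      set of equations separately.\<close>
    then show "k * card F < 2 * card (\<Union>j\<in>F. e j)"
      using expand[of "card F"] \<tau> F J by (force simp: nonexpanding_def e_def)
  qed (use k q in auto)
  have d: "degree_bound = d"
    by (simp add: degree_bound_def d_def)
  have "card B * ?D \<le> k * ?N"
    unfolding B_def using \<tau>_mem by (rule card_high_degree_le)
  then have "(4 * card B) * (k * C) \<le> m * (k * C)"
    by (simp add: mult_ac)
  then have card_B: "4 * card B \<le> m"
    using k C by simp
  have "unsatisfiable r" if r: "r \<in> {..<?N} \<rightarrow>\<^sub>E UNIV" "r \<notin> nearly_satisfiable ?N m {1..m} \<tau>" for r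
    unfolding unsatisfiable_def
  proof (intro allI impI)
    fix W a assume W: "a \<subseteq> W" "W \<subseteq> {1..m}" "m \<le> 2 * card W"
    have "card W - card B \<le> card (W - B)"
      by (rule diff_card_le_card_Diff) (simp add: B_def)
    then have "card {1..m} \<le> 4 * card (W - B)"
      using card_B W(3) by simp
    moreover have "a - B \<subseteq> W - B" "W - B \<subseteq> {1..m}"
      using W by auto
    ultimately have "\<not> card {j \<in> {..<?N}. violated (W - B) (a - B) (\<tau> j) (r j)} \<le> m"
      using r unfolding nearly_satisfiable_def by blast
    then have "m < card {j \<in> {..<?N}. violated (W - B) (a - B) (\<tau> j) (r j)}"
      by simp
    \<comment> \<open>An equation counted on the left has distinct variables and avoids
      \<open>B\<close>, so it was not discarded; within \<open>W - B\<close> the assignments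
      \<open>a\<close> and \<open>a - B\<close> agree.\<close>
    also have "\<dots> \<le> card {j \<in> J. e j \<subseteq> W \<and> r j \<noteq> odd (card (a \<inter> e j))}"
    proof (rule card_mono)
      show "finite {j \<in> J. e j \<subseteq> W \<and> r j \<noteq> odd (card (a \<inter> e j))}"
        using finite_J by simp
      show "{j \<in> {..<?N}. violated (W - B) (a - B) (\<tau> j) (r j)} \<subseteq>
          {j \<in> J. e j \<subseteq> W \<and> r j \<noteq> odd (card (a \<inter> e j))}"
      proof
        fix j assume j: "j \<in> {j \<in> {..<?N}. violated (W - B) (a - B) (\<tau> j) (r j)}"
        then have "(a - B) \<inter> set (\<tau> j) = a \<inter> set (\<tau> j)"
          by (auto simp: violated_def)
        with j show "j \<in> {j \<in> J. e j \<subseteq> W \<and> r j \<noteq> odd (card (a \<inter> e j))}"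
          by (auto simp: violated_def J_def e_def)
      qed
    qed
    finally show "m < card {j \<in> J. e j \<subseteq> W \<and> r j \<noteq> odd (card (a \<inter> e j))}" .
  qed
  then have "{r \<in> {..<?N} \<rightarrow>\<^sub>E UNIV. \<not> unsatisfiable r} \<subseteq> nearly_satisfiable ?N m {1..m} \<tau>"
    by blast
  moreover have "finite (nearly_satisfiable ?N m {1..m} \<tau>)"
    unfolding nearly_satisfiable_def by (intro finite_Collect_conjI disjI1) (simp add: finite_PiE)
  ultimately have "card {r \<in> {..<?N} \<rightarrow>\<^sub>E UNIV. \<not> unsatisfiable r} \<le> card (nearly_satisfiable ?N m {1..m} \<tau>)"
    by (intro card_mono)
  with unsat have "2 * card {r \<in> {..<?N} \<rightarrow>\<^sub>E UNIV. \<not> unsatisfiable r} < 2 ^ ?N"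
    by linarith
  then show False
  proof (rule no_tester[OF J n])
    show "tester k degree_bound (1 / (2 * real degree_bound)) (independence_number_ge 2) n T"
      using tester by (simp add: d)
    fix t r assume t: "t \<in> set_pmf T"
    have "bounded_degree_input k d n (hyperedges r) (incidences r)"
      using input_incidences[of n r] n by (simp add: d)
    with t show "num_queries (answer n degree_bound (incidences r)) t \<le> q"
      unfolding d by (rule few)
  qed
qed

lemma omega_linear_query_complexity:
  fixes k C :: nat
  assumes k: "k \<ge> 3" and C: "C \<ge> 1" and decay: "(1 - 1 / (4 * 8 ^ k) :: real) ^ C \<le> 1 / 32"
  defines "d \<equiv> 4 * k * C * 2 ^ k"
  shows "omega_linear (query_complexity k d (1 / (2 * real d)) (independence_number_ge 2))"
proof -
  define K where "K = 1944 * C\<^sup>2 * k ^ 3"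
  have K: "K \<ge> 1"
    using k C by (simp add: K_def Suc_le_eq)
  let ?\<epsilon> = "1 / (2 * real d)" and ?P = "independence_number_ge 2"
  have "ereal (1 / (4 * real K) * real n) \<le> ereal_of_enat (query_complexity k d ?\<epsilon> ?P n)"
    if n: "n \<ge> 8 * K + 32 * k" for n
  proof (rule ccontr)
    assume "\<not> ?thesis"
    then have less: "ereal_of_enat (query_complexity k d ?\<epsilon> ?P n) < ereal (1 / (4 * real K) * real n)"
      by simp
    then obtain q where q: "query_complexity k d ?\<epsilon> ?P n = enat q"
      by (cases "query_complexity k d ?\<epsilon> ?P n") auto
    have "real q < 1 / (4 * real K) * real n"
      using less by (simp add: q)
    then have "real (q * (4 * K)) < real n"
      using K by (simp add: field_simps)
    then have qn: "q * K * 4 < n"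
      unfolding of_nat_less_iff by (simp add: mult_ac)
    \<comment> \<open>With the strict bound \<open>Suc q\<close> the infimum yields an actual tester
      making at most \<open>q\<close> queries.\<close>
    have "(INF T \<in> {T. tester k d ?\<epsilon> ?P n T}. worst_case_queries k d n T) < enat (Suc q)"
      using q by (simp add: query_complexity_def)
    then obtain T where T: "tester k d ?\<epsilon> ?P n T" "worst_case_queries k d n T < enat (Suc q)"
      by (auto simp: INF_less_iff)
    \<comment> \<open>The maximum with 2 meets the requirement \<open>q \<ge> 2\<close>; the lower
      bound on \<open>n\<close> pays for it.\<close>
    have few: "num_queries (answer n d A) t \<le> max 2 q"
      if "t \<in> set_pmf T" "bounded_degree_input k d n E A" for t A E
    proof -
      have "enat (num_queries (answer n d A) t) \<le> (SUP t \<in> set_pmf T. enat (num_queries (answer n d A) t))"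
        using that by (intro SUP_upper)
      also have "\<dots> \<le> worst_case_queries k d n T"
        unfolding worst_case_queries_def using that by (intro SUP_upper) auto
      finally have "enat (num_queries (answer n d A) t) < enat (Suc q)"
        using T(2) by (rule le_less_trans)
      then show ?thesis
        by simp
    qed
    have "max 2 q * K \<le> n div 2"
      using qn n by (cases "q \<le> 2") (auto simp: max_def)
    moreover have "8 * k \<le> n div 2" "n \<ge> 2"
      using n K by auto
    ultimately show False
      using no_tester_with_few_queries[OF k C _ refl _ _ _ decay, of "max 2 q" n T] T(1) few
      unfolding K_def d_def by auto
  qed
  then show ?thesis
    unfolding omega_linear_def using K
    by (intro exI[of _ "1 / (4 * real K)"] conjI eventually_sequentiallyI[of "8 * K + 32 * k"]) auto
qed

theorem theorem4:
  fixes k :: nat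
  assumes "k \<ge> 3"
  shows "\<exists>(d_ind :: nat) (\<epsilon>_ind :: real) (\<alpha>_ind :: real).
           d_ind > 0 \<and> \<epsilon>_ind > 0 \<and> \<alpha>_ind > 0 \<and>
           omega_linear (query_complexity k d_ind \<epsilon>_ind (independence_number_ge \<alpha>_ind))"
proof -
  \<comment> \<open>The base lies strictly between 0 and 1 and depends on \<open>k\<close> alone, so
    \<open>C\<close>, and with it the degree bound and the proximity parameter, are
    constants.\<close>
  obtain C where C: "(1 - 1 / (4 * 8 ^ k) :: real) ^ C < 1 / 32"
    using real_arch_pow_inv[of "1 / 32" "1 - 1 / (4 * 8 ^ k) :: real"] by auto
  then have "C \<ge> 1"
    by (cases C) auto
  let ?d = "4 * k * C * 2 ^ k"
  have "?d > 0"
    using \<open>C \<ge> 1\<close> assms by simp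
  moreover have "omega_linear (query_complexity k ?d (1 / (2 * real ?d)) (independence_number_ge 2))"
    using assms \<open>C \<ge> 1\<close> C by (intro omega_linear_query_complexity) auto
  ultimately show ?thesis
    by (intro exI[of _ ?d] exI[of _ "1 / (2 * real ?d)"] exI[of _ 2]) simp
qed

end
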